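(* Let $\mathcal T=(V,E)$ be an undirected tree on $V=\{1,\dots,d\}$, and let $\boldsymbol Y$ have a multivariate Pareto distribution with positive and continuous density on $\mathcal L$ that factorizes with respect to $\mathcal T$. Fix $k\in V$, let $\mathcal T^k=(V,E^k)$ be the directed tree obtained from $\mathcal T$ by orienting all edges away from $k$, let $(U_e)_{e\in E^k}$ be independent random variables where, for $e=(i,j)\in E^k$, $U_e$ has the distribution of the extremal function $U^i_j$ of $\lambda_{ij}$ at coordinate $j$ relative to coordinate $i$, and let $P$ be a standard Pareto random variable independent of $(U_e)_{e\in E^k}$. Then we have the joint stochastic representation of $\boldsymbol Y^k$ on $\mathcal L^k$ $$Y_i^k\stackrel{d}{=}\begin{cases}P,&i=k,\\ P\times\prod_{e\in\mathrm{ph}(ki)}U_e,&i\in V\setminus\{k\},\end{cases}$$ (equality in distribution of the $d$-dimensional vectors), where $\mathrm{ph}(ki)$ denotes the set of edges on the unique path from node $k$ to node $i$ on $\mathcal T^k$.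
   Context: Setting. $V=\{1,\dots,d\}$, $d\ge2$; $\mathcal E=[0,\infty)^d\setminus\{\boldsymbol 0\}$; $\mathcal L=\{\boldsymbol x\in\mathcal E:\|\boldsymbol x\|_\infty>1\}$; $\mathcal L^k=\{\boldsymbol x\in\mathcal L:x_k>1\}$. Multivariate Pareto distribution with positive continuous density: there is a positive continuous function $\lambda$ (the exponent measure density) satisfying (L1) $\lambda(t\boldsymbol y)=t^{-(d+1)}\lambda(\boldsymbol y)$ for all $t>0$, and (L2) $\int_{\{\boldsymbol y\in\mathcal E:\,y_i>1\}}\lambda(\boldsymbol y)\,\mathrm d\boldsymbol y=1$ for $i=1,\dots,d$, such that $\boldsymbol Y$ takes values in $\mathcal L$ with Lebesgue density $f_{\boldsymbol Y}(\boldsymbol y)=\lambda(\boldsymbol y)/\Lambda(\boldsymbol 1)$, where $\Lambda(\boldsymbol 1)=\int_{\mathcal L}\lambda(\boldsymbol y)\,\mathrm d\boldsymbol y$. Densities are considered at points with strictly positive coordinates (faces have zero mass). $\lambda_{ij}(y_i,y_j)$ is the bivariate marginal of $\lambda$ obtained by integrating out all other coordinates over $[0,\infty)^{d-2}$. Factorization with respect to the tree $\mathcal T$: $$f_{\boldsymbol Y}(\boldsymbol y)=\frac1{\Lambda(\boldsymbol 1)}\prod_{\{i,j\}\in E}\frac{\lambda_{ij}(y_i,y_j)}{y_i^{-2}y_j^{-2}}\prod_{i\in V}y_i^{-2},\qquad\boldsymbol y\in\mathcal L.$$ $\boldsymbol Y^k$ is $\boldsymbol Y$ conditioned on $\{Y_k>1\}$;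 its density on $\mathcal L^k$ is $\lambda$. Extremal function of $\lambda_{ij}$ at coordinate $j$ relative to coordinate $i$: the positive random variable $U^i_j$ (with mean 1) whose density $f_{U^i_j}$ satisfies $\lambda_{ij}(y_i,y_j)=y_i^{-3}f_{U^i_j}(y_j/y_i)$, i.e. $f_{U^i_j}(u)=\lambda_{ij}(1,u)$, $u>0$. Standard Pareto: $\mathbb P(P>x)=1/x$, $x\ge1$. *)

theory Defs
  imports "HOL-Probability.Probability" "Graph_Theory.Digraph_Component"
begin

text \<open>
  A simple undirected graph is given by its vertex set \<open>V\<close> and its set \<open>E\<close> of two-element edges.
  Walks in it are those of the associated symmetric digraph. \<open>Digraph_Component.tree\<close> forbids all
  directed cycles, including the cycles \<open>u, v, u\<close> that every symmetric digraph with an edge has,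
  so it does not describe undirected trees; here only cycles of length at least 3 are forbidden.
\<close>

definition sym_digraph :: "'v set \<Rightarrow> 'v set set \<Rightarrow> 'v pair_pre_digraph" where
  "sym_digraph V E = \<lparr>pverts = V, parcs = {(u, v). {u, v} \<in> E}\<rparr>"

definition undirected_tree :: "'v set \<Rightarrow> 'v set set \<Rightarrow> bool" where
  "undirected_tree V E \<longleftrightarrow>
     E \<subseteq> {{u, v} | u v. u \<in> V \<and> v \<in> V \<and> u \<noteq> v} \<and>
     Digraph_Component.connected (with_proj (sym_digraph V E)) \<and>
     \<not> (\<exists>p. pre_digraph.cycle (with_proj (sym_digraph V E)) p \<and> 3 \<le> length p)"

text \<open>
  The edges oriented away from \<open>k\<close>: \<open>{i, j}\<close> becomes \<open>(i, j)\<close> if some path starting in \<open>k\<close> ends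
  by traversing the edge from \<open>i\<close> to \<open>j\<close>.
\<close>

definition oriented_edges :: "'v set \<Rightarrow> 'v set set \<Rightarrow> 'v \<Rightarrow> ('v \<times> 'v) set" where
  "oriented_edges V E k =
     {(i, j). \<exists>p. pre_digraph.apath (with_proj (sym_digraph V E)) k (p @ [(i, j)]) j}"

definition directed_tree :: "'v set \<Rightarrow> 'v set set \<Rightarrow> 'v \<Rightarrow> 'v pair_pre_digraph" where
  "directed_tree V E k = \<lparr>pverts = V, parcs = oriented_edges V E k\<rparr>"

definition ph :: "'v set \<Rightarrow> 'v set set \<Rightarrow> 'v \<Rightarrow> 'v \<Rightarrow> ('v \<times> 'v) set" where
  "ph V E k i = set (THE p. pre_digraph.apath (with_proj (directed_tree V E k)) k p i)"

text \<open>
  Vectors indexed by \<open>V\<close> are the functions in \<open>extensional V\<close>, which is the space of the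
  product measures over \<open>V\<close>.
\<close>

abbreviation lborel_on :: "'v set \<Rightarrow> ('v \<Rightarrow> real) measure" where
  "lborel_on V \<equiv> \<Pi>\<^sub>M i\<in>V. lborel"

abbreviation borel_on :: "'v set \<Rightarrow> ('v \<Rightarrow> real) measure" where
  "borel_on V \<equiv> \<Pi>\<^sub>M i\<in>V. borel"

definition E_space :: "'v set \<Rightarrow> ('v \<Rightarrow> real) set" where
  "E_space V = (\<Pi>\<^sub>E i\<in>V. {0..}) - {\<lambda>i\<in>V. 0}"

definition L_space :: "'v set \<Rightarrow> ('v \<Rightarrow> real) set" where
  "L_space V = {x \<in> E_space V. Max ((\<lambda>i. \<bar>x i\<bar>) ` V) > 1}"

definition pos_orthant :: "'v set \<Rightarrow> ('v \<Rightarrow> real) set" where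
  "pos_orthant V = (\<Pi>\<^sub>E i\<in>V. {0<..})"

text \<open>
  Densities are only considered at points with strictly positive coordinates. The values of
  \<open>lam\<close> on the faces of \<open>E_space V\<close>, a null set, are unconstrained and do not affect any of the
  integrals below.
\<close>

definition exponent_measure_density :: "'v set \<Rightarrow> (('v \<Rightarrow> real) \<Rightarrow> real) \<Rightarrow> bool" where
  "exponent_measure_density V lam \<longleftrightarrow>
     (\<forall>y \<in> pos_orthant V. 0 < lam y) \<and>
     continuous_on (pos_orthant V) lam \<and>
     (\<forall>t > 0. \<forall>y \<in> pos_orthant V.
        lam (\<lambda>i\<in>V. t * y i) = t powr (- (real (card V) + 1)) * lam y) \<and>
     (\<forall>i \<in> V. (\<integral>\<^sup>+ y \<in> {y \<in> E_space V. y i > 1}. ennreal (lam y) \<partial>lborel_on V) = 1)"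

definition Lambda_one :: "'v set \<Rightarrow> (('v \<Rightarrow> real) \<Rightarrow> real) \<Rightarrow> real" where
  "Lambda_one V lam = enn2real (\<integral>\<^sup>+ y \<in> L_space V. ennreal (lam y) \<partial>lborel_on V)"

definition pareto_density :: "'v set \<Rightarrow> (('v \<Rightarrow> real) \<Rightarrow> real) \<Rightarrow> ('v \<Rightarrow> real) \<Rightarrow> real" where
  "pareto_density V lam y =
     (if y \<in> L_space V \<inter> pos_orthant V then lam y / Lambda_one V lam else 0)"

text \<open>That \<open>Y\<close> takes its values in \<open>L_space V\<close> (almost surely) is part of the density.\<close>

definition multivariate_pareto ::
  "'v set \<Rightarrow> (('v \<Rightarrow> real) \<Rightarrow> real) \<Rightarrow> 'a measure \<Rightarrow> ('a \<Rightarrow> 'v \<Rightarrow> real) \<Rightarrow> bool" where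
  "multivariate_pareto V lam M Y \<longleftrightarrow>
     exponent_measure_density V lam \<and>
     distributed M (lborel_on V) Y (\<lambda>y. ennreal (pareto_density V lam y))"

text \<open>
  The marginal of \<open>lam\<close> on the coordinates in \<open>I\<close>, at the point with coordinates \<open>y i\<close>, \<open>i \<in> I\<close>.
  For \<open>I = {i, j}\<close> this is the bivariate marginal at \<open>(y i, y j)\<close>; indexing by the set makes it
  independent of the order of \<open>i\<close> and \<open>j\<close>.
\<close>

definition marginal ::
  "'v set \<Rightarrow> (('v \<Rightarrow> real) \<Rightarrow> real) \<Rightarrow> 'v set \<Rightarrow> ('v \<Rightarrow> real) \<Rightarrow> real" where
  "marginal V lam I y =
     enn2real (\<integral>\<^sup>+ z \<in> (\<Pi>\<^sub>E l\<in>V - I. {0..}). ennreal (lam (merge I (V - I) (y, z)))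
       \<partial>lborel_on (V - I))"

definition factorizes :: "'v set \<Rightarrow> 'v set set \<Rightarrow> (('v \<Rightarrow> real) \<Rightarrow> real) \<Rightarrow> bool" where
  "factorizes V E lam \<longleftrightarrow>
     (\<forall>y \<in> L_space V \<inter> pos_orthant V.
        pareto_density V lam y =
          1 / Lambda_one V lam *
          (\<Prod>e\<in>E. marginal V lam e y / (\<Prod>i\<in>e. y i powr (- 2))) * (\<Prod>i\<in>V. y i powr (- 2)))"

text \<open>
  The density \<open>f\<close> of the extremal function at \<open>j\<close> relative to \<open>i\<close> is determined by
  \<open>lam_ij (a, b) = a powr (- 3) * f (b / a)\<close>; taking \<open>a = 1\<close> gives \<open>f u = lam_ij (1, u)\<close>.
\<close>

definition extremal_density ::
  "'v set \<Rightarrow> (('v \<Rightarrow> real) \<Rightarrow> real) \<Rightarrow> 'v \<Rightarrow> 'v \<Rightarrow> real \<Rightarrow> real" where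
  "extremal_density V lam i j u =
     (if 0 < u then marginal V lam {i, j} (\<lambda>l. if l = i then 1 else u) else 0)"

definition standard_pareto :: "'b measure \<Rightarrow> ('b \<Rightarrow> real) \<Rightarrow> bool" where
  "standard_pareto N P \<longleftrightarrow>
     P \<in> borel_measurable N \<and> (\<forall>x \<ge> 1. measure N {w \<in> space N. P w > x} = 1 / x)"

text \<open>
  Independence of two random variables through the sigma-algebras they generate; \<open>indep_var\<close>
  requires both to have the same range type.
\<close>

definition indep_rv ::
  "'b measure \<Rightarrow> 's measure \<Rightarrow> ('b \<Rightarrow> 's) \<Rightarrow> 't measure \<Rightarrow> ('b \<Rightarrow> 't) \<Rightarrow> bool" where
  "indep_rv N S X T Z \<longleftrightarrow>
     X \<in> measurable N S \<and> Z \<in> measurable N T \<and>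
     prob_space.indep_set N
       (sigma_sets (space N) {X -` A \<inter> space N | A. A \<in> sets S})
       (sigma_sets (space N) {Z -` A \<inter> space N | A. A \<in> sets T})"

end

theory Submission
  imports Defs
begin

text \<open>
  Every vertex \<open>j \<noteq> k\<close> has a unique parent \<open>i\<close>, and \<open>\<lambda>\<^sub>i\<^sub>j(y\<^sub>i, y\<^sub>j) = y\<^sub>i\<^sup>-\<^sup>3 f\<^sub>i\<^sub>j(y\<^sub>j / y\<^sub>i)\<close> by
  homogeneity, so the factorization of \<open>\<lambda>\<close> becomes \<open>y\<^sub>k\<^sup>-\<^sup>2\<close> times the product over the arcs \<open>(i, j)\<close> of
  \<open>f\<^sub>i\<^sub>j(y\<^sub>j / y\<^sub>i) / y\<^sub>i\<close>. This is the density of the products of a standard Pareto variable and the extremal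
  functions along the paths from \<open>k\<close>: attach the leaves one at a time and substitute
  \<open>y\<^sub>j = y\<^sub>i u\<close> for the factor \<open>u\<close> of the new arc.
\<close>

subsection \<open>Paths in undirected trees\<close>

text \<open>The random factors are indexed by arcs, the density by vertices. Naming each arc by its
  head puts \<open>P\<close> and all factors on one product space over \<open>V\<close>, where both
  laws become densities that can be compared. No d-dimensional Jacobian is computed: integrals of
  arbitrary test functions are compared instead, so a new leaf costs one application of Tonelli and
  one linear substitution in a single real variable. That substitution needs a positive parent
  coordinate, which holds wherever the density is nonzero. The exponents match for this reason: a
  marginal on two coordinates is homogeneous of degree -3; dividing by the two vertex powers of the
  edge and spending the vertex power of \<open>j\<close> on the arc entering \<open>j\<close> leaves
  1 over the parent coordinate, exactly the Jacobian of the substitution. Only the power -2 of the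
  root coordinate is left, which is the Pareto density. The constant Lambda(1) disappears because
  (L2) makes its reciprocal the probability of the conditioning event.\<close>

lemma sym_digraph_simps [simp]:
  "pverts (sym_digraph V E) = V" "(i, j) \<in> parcs (sym_digraph V E) \<longleftrightarrow> {i, j} \<in> E"
  by (simp_all add: sym_digraph_def)

lemma directed_tree_simps [simp]:
  "pverts (directed_tree V E k) = V" "parcs (directed_tree V E k) = oriented_edges V E k"
  by (simp_all add: directed_tree_def)

context pair_sym_digraph
begin

text \<open>Induction on the first path. A common first arc is stripped from both; distinct first
  arcs give a cycle made of two arcs at \<open>u\<close> and a nonempty path between their other
  ends, hence of length at least 3.\<close>

lemma apath_unique:
  assumes acyclic: "\<And>c. cycle c \<Longrightarrow> length c < 3"
  assumes "apath u p v" "apath u q v"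
  shows "p = q"
  using assms(2,3)
proof (induction p arbitrary: u q)
  case Nil
  then show ?case
    by (metis apath_Nil_iff apath_nonempty_ends)
next
  case (Cons e es)
  show ?case
  proof (cases q)
    case Nil
    with Cons.prems show ?thesis
      using apath_nonempty_ends[of u "e # es" v] by (simp add: apath_Nil_iff)
  next
    case q: (Cons f fs)
    show ?thesis
    proof (cases "e = f")
      case True
      with Cons q show ?thesis
        by (auto simp: apath_Cons_iff)
    next
      case False
      obtain x y where e: "e = (u, x)" and f: "f = (u, y)" and "x \<noteq> y"
        using Cons.prems q False by (cases e; cases f) (auto simp: apath_Cons_iff)
      have x: "apath x es v" "u \<notin> set (awalk_verts x es)" "(u, x) \<in> parcs G"
        using Cons.prems e by (auto simp: apath_Cons_iff)
      have y: "apath y fs v" "u \<notin> set (awalk_verts y fs)" "(u, y) \<in> parcs G"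
        using Cons.prems q f by (auto simp: apath_Cons_iff)
      have walks: "awalk x es v" "awalk v (rev_path fs) y"
        using x y by (auto simp: apath_def)
      \<comment> \<open>Paths diverging at \<open>u\<close> are joined by a path avoiding \<open>u\<close>, which closes up to a cycle through \<open>u\<close>.\<close>
      define r where "r = awalk_to_apath (es @ rev_path fs)"
      have w: "awalk x (es @ rev_path fs) y"
        using walks by auto
      have r: "apath x r y" "set r \<subseteq> set (es @ rev_path fs)"
        unfolding r_def using apath_awalk_to_apath[OF w] awalk_to_apath_subset[OF w] by simp_all
      have "set (awalk_verts x (es @ rev_path fs)) = set (awalk_verts x es) \<union> set (awalk_verts y fs)"
        using walks y by (simp add: set_awalk_verts_append awalk_verts_rev_path)
      moreover have "set (awalk_verts x r) \<subseteq> set (awalk_verts x (es @ rev_path fs))"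
      proof -
        have "awalk x r y"
          using r(1) by (simp add: apath_def)
        then show ?thesis
          unfolding set_awalk_verts[OF w] using r(2) by (simp add: set_awalk_verts) blast
      qed
      ultimately have u: "u \<notin> set (awalk_verts x r)"
        using x y by auto
      have "r \<noteq> []"
        using r \<open>x \<noteq> y\<close> by (auto simp: apath_simps)
      have walk: "awalk x (r @ [(y, u)]) u"
        using r y by (auto simp: apath_def awalk_simps intro: arcs_symmetric in_arcsD1)
      have verts: "awalk_verts x (r @ [(y, u)]) = awalk_verts x r @ [u]"
        using awalk_verts_append[OF walk] by simp
      have "cycle ((u, x) # r @ [(y, u)])"
        unfolding cycle_def using walk verts r u x by (intro exI[of _ u])
          (auto simp: awalk_Cons_iff apath_def in_arcsD1)
      with acyclic \<open>r \<noteq> []\<close> show ?thesis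
        by (cases r) fastforce+
    qed
  qed
qed

lemma apath_snoc_iff:
  "apath u (p @ [(i, j)]) v \<longleftrightarrow>
     apath u p i \<and> (i, j) \<in> parcs G \<and> j \<notin> set (awalk_verts u p) \<and> v = j"
proof -
  have "apath u p i \<Longrightarrow> last (pawalk_verts u p) = i"
    by (auto simp: apath_def)
  then show ?thesis
    by (fastforce simp: apath_append_iff apath_simps in_arcsD1 in_arcsD2)
qed

end

section \<open>Rooting the tree: parents, oriented arcs and paths from the root\<close>

locale rooted_tree =
  fixes V :: "'v set" and E :: "'v set set" and k :: 'v
  assumes tree: "undirected_tree V E" and root: "k \<in> V" and finite_V: "finite V"
begin

sublocale G: pair_sym_digraph "sym_digraph V E"
proof
  fix e assume "e \<in> parcs (sym_digraph V E)"
  then show "fst e \<in> pverts (sym_digraph V E)" "snd e \<in> pverts (sym_digraph V E)"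
    using tree by (auto simp: sym_digraph_def undirected_tree_def doubleton_eq_iff)
next
  show "symmetric (with_proj (sym_digraph V E))"
    by (auto simp: symmetric_def sym_digraph_def insert_commute intro!: symI)
qed

lemma acyclic: "G.cycle c \<Longrightarrow> length c < 3"
  using tree by (auto simp: undirected_tree_def not_le)

lemma ex1_apath:
  assumes "i \<in> V"
  shows "\<exists>!p. G.apath k p i"
proof -
  \<comment> \<open>Connectedness means strong connectedness of the symmetric closure, and this
    digraph is its own symmetric closure.\<close>
  have "k \<rightarrow>\<^sup>*\<^bsub>mk_symmetric (with_proj (sym_digraph V E))\<^esub> i"
    using tree root assms
    by (auto simp: undirected_tree_def connected_def strongly_connected_def)
  then have "k \<rightarrow>\<^sup>*\<^bsub>with_proj (sym_digraph V E)\<^esub> i"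
    using G.reachable_mk_symmetric_eq[OF G.pair_sym_arcs] by simp
  then show ?thesis
    using G.apath_unique[OF acyclic] by (auto simp: G.reachable_apath)
qed

definition root_path :: "'v \<Rightarrow> ('v \<times> 'v) list" where
  "root_path i = (THE p. G.apath k p i)"

lemma root_path_iff: "i \<in> V \<Longrightarrow> G.apath k p i \<longleftrightarrow> p = root_path i"
  using ex1_apath unfolding root_path_def by (metis the_equality)

text \<open>The root path of \<open>k\<close> is empty, so the value at \<open>k\<close> carries no
  meaning; uses are confined to \<open>V - {k}\<close>.\<close>

definition parent :: "'v \<Rightarrow> 'v" where
  "parent j = fst (last (root_path j))"

text \<open>Since paths from \<open>k\<close> are unique, only one arc can end a path to
  \<open>j\<close>. The oriented edges are thus the graph of a function of the head, which lets arcs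
  be indexed by vertices.\<close>

lemma oriented_edges_iff: "(i, j) \<in> oriented_edges V E k \<longleftrightarrow> j \<in> V - {k} \<and> i = parent j"
proof
  assume "(i, j) \<in> oriented_edges V E k"
  then obtain p where p: "G.apath k (p @ [(i, j)]) j"
    by (auto simp: oriented_edges_def)
  moreover have "j \<in> V"
    using p by (auto simp: G.apath_def dest: G.awalk_last_in_verts)
  moreover have "j \<noteq> k"
    using p G.apath_nonempty_ends by fastforce
  ultimately show "j \<in> V - {k} \<and> i = parent j"
    by (auto simp: root_path_iff parent_def dest: sym)
next
  assume j: "j \<in> V - {k} \<and> i = parent j"
  then have path: "G.apath k (root_path j) j"
    using root_path_iff by blast
  then show "(i, j) \<in> oriented_edges V E k"
    using j by (cases "root_path j" rule: rev_cases)
      (auto simp: oriented_edges_def parent_def G.apath_simps G.apath_snoc_iff)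
qed

text \<open>Dropping the last arc of the path to \<open>j\<close> leaves a path from
  \<open>k\<close>, which by uniqueness is the root path of the parent. Depth therefore drops by
  one, the basis of all later inductions.\<close>

lemma
  assumes "j \<in> V - {k}"
  shows parent_in: "parent j \<in> V"
    and root_path_snoc: "root_path j = root_path (parent j) @ [(parent j, j)]"
    and parent_edge: "{parent j, j} \<in> E"
proof -
  obtain p where p: "G.apath k (p @ [(parent j, j)]) j"
    using oriented_edges_iff[of "parent j" j] assms by (auto simp: oriented_edges_def)
  then have p': "G.apath k p (parent j)" "{parent j, j} \<in> E" "j \<notin> set (G.awalk_verts k p)"
    by (auto simp: G.apath_snoc_iff)
  show "parent j \<in> V"
    using p' by (auto simp: G.apath_def dest: G.awalk_last_in_verts)
  with p' have r: "root_path (parent j) = p"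
    by (simp add: root_path_iff)
  show "root_path j = root_path (parent j) @ [(parent j, j)]"
    using p assms r by (simp add: root_path_iff)
  show "{parent j, j} \<in> E" by fact
qed

lemma root_path_root: "root_path k = []"
  using root root_path_iff[of k "[]"] by (auto simp: G.apath_Nil_iff)

lemma length_root_path_parent: "j \<in> V - {k} \<Longrightarrow> length (root_path (parent j)) < length (root_path j)"
  by (simp add: root_path_snoc)

text \<open>If two vertices had the same parent edge, each would be the parent of the other, against
  the decrease of depth. For surjectivity take an edge between \<open>i\<close> and
  \<open>j\<close>: a path to \<open>i\<close> that avoids \<open>j\<close> extends to
  \<open>j\<close>; one that meets \<open>j\<close> is cut there and continued by the arc from
  \<open>j\<close> to \<open>i\<close>.\<close>

lemma bij_betw_parent_edge: "bij_betw (\<lambda>j. {parent j, j}) (V - {k}) E"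
proof (intro bij_betw_imageI inj_onI)
  fix i j assume "i \<in> V - {k}" "j \<in> V - {k}" "{parent i, i} = {parent j, j}"
  then show "i = j"
    using length_root_path_parent[of i] length_root_path_parent[of j]
    by (auto simp: doubleton_eq_iff)
next
  show "(\<lambda>j. {parent j, j}) ` (V - {k}) = E"
  proof (intro equalityI subsetI)
    fix e assume e: "e \<in> E"
    then obtain i j where ij: "e = {i, j}" "i \<noteq> j" "i \<in> V" "j \<in> V"
      using tree by (auto simp: undirected_tree_def)
    have arcs: "(i, j) \<in> parcs (sym_digraph V E)" "(j, i) \<in> parcs (sym_digraph V E)"
      using e ij by (auto simp: insert_commute)
    have path: "G.apath k (root_path i) i"
      using ij root_path_iff by blast
    have "(i, j) \<in> oriented_edges V E k \<or> (j, i) \<in> oriented_edges V E k"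
    proof (cases "j \<in> set (G.awalk_verts k (root_path i))")
      case False
      then have "G.apath k (root_path i @ [(i, j)]) j"
        using path arcs by (simp add: G.apath_snoc_iff)
      then show ?thesis
        by (auto simp: oriented_edges_def)
    next
      case True
      then obtain q r where qr: "root_path i = q @ r" "G.awalk k q j" "G.awalk j r i"
        using path G.awalk_decomp by (metis G.apath_def)
      then have q: "G.apath k q j" and disj: "set (G.awalk_verts k q) \<inter> set (tl (G.awalk_verts j r)) = {}"
        using path by (auto simp: G.apath_append_iff)
      have "r \<noteq> []"
        using qr ij by (auto simp: G.awalk_Nil_iff)
      then have "i \<in> set (tl (G.awalk_verts j r))"
        using qr(3) by (auto simp: G.awalk_def G.awalk_verts_conv' G.awalk_verts_conv
            dest!: G.awlast_if_cas split: if_splits)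
      then have "G.apath k (q @ [(j, i)]) i"
        using q disj arcs by (auto simp: G.apath_snoc_iff)
      then show ?thesis
        by (auto simp: oriented_edges_def)
    qed
    then show "e \<in> (\<lambda>j. {parent j, j}) ` (V - {k})"
      using ij by (auto simp: oriented_edges_iff)
  qed (use parent_edge in auto)
qed

lemma set_root_path: "i \<in> V \<Longrightarrow> set (root_path i) \<subseteq> oriented_edges V E k"
proof (induction "length (root_path i)" arbitrary: i rule: less_induct)
  case less
  show ?case
  proof (cases "i = k")
    case False
    with less show ?thesis
      using root_path_snoc[of i] parent_in[of i] by (auto simp: oriented_edges_iff)
  qed (simp add: root_path_root)
qed

text \<open>Directed paths are also paths of the symmetric digraph, so uniqueness carries over; the
  root path itself survives the orientation because all its arcs point away from
  \<open>k\<close>.\<close>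

lemma ph_eq: 
  assumes "i \<in> V"
  shows "ph V E k i = set (root_path i)"
proof -
  let ?D = "directed_tree V E k"
  interpret D: pair_wf_digraph ?D
    by unfold_locales (auto simp: oriented_edges_iff parent_in)
  have sub: "parcs ?D \<subseteq> parcs (sym_digraph V E)"
    using parent_edge by (auto simp: oriented_edges_iff)
  have "D.apath k p i \<longleftrightarrow> p = root_path i" for p
  proof
    assume "D.apath k p i"
    then have "G.apath k p i"
      using sub by (auto simp: D.apath_def G.apath_def D.awalk_def G.awalk_def
       )
    with assms show "p = root_path i"
      by (simp add: root_path_iff)
  next
    assume "p = root_path i"
    then have "G.apath k p i" "set p \<subseteq> parcs ?D"
      using assms set_root_path root_path_iff by auto
    then show "D.apath k p i"
      by (auto simp: D.apath_def G.apath_def D.awalk_def G.awalk_def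
       )
  qed
  then show ?thesis
    by (simp add: ph_def)
qed

lemma ph_root: "ph V E k k = {}"
  by (simp add: ph_eq root root_path_root)

lemma ph_parent:
  "j \<in> V - {k} \<Longrightarrow> ph V E k j = insert (parent j, j) (ph V E k (parent j))"
  by (simp add: ph_eq parent_in root_path_snoc)

lemma ph_subset: "i \<in> V \<Longrightarrow> ph V E k i \<subseteq> oriented_edges V E k"
  by (simp add: ph_eq set_root_path)

text \<open>This is the change of index from arcs to non-root vertices.\<close>

lemma bij_betw_snd: "bij_betw snd (oriented_edges V E k) (V - {k})"
  by (rule bij_betw_byWitness[where f' = "\<lambda>j. (parent j, j)"]) (auto simp: oriented_edges_iff)

subsection \<open>Products along the paths of a rooted tree\<close>


text \<open>These are the vertex sets of subtrees containing the root; their arcs are determined by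
  \<open>parent\<close>.\<close>

definition subtree :: "'v set \<Rightarrow> bool" where
  "subtree S \<longleftrightarrow> S \<subseteq> V \<and> k \<in> S \<and> parent ` (S - {k}) \<subseteq> S"

lemma subtree_V: "subtree V"
  using root parent_in by (auto simp: subtree_def)

lemma subtree_finite: "subtree S \<Longrightarrow> finite S"
  using finite_V by (auto simp: subtree_def intro: finite_subset)

text \<open>A vertex of maximal depth in \<open>S\<close> is the parent of no vertex of
  \<open>S\<close>, so removing it leaves a subtree.\<close>

lemma subtree_induct [consumes 1, case_names root leaf]:
  assumes "subtree S" and "P {k}"
    and leaf: "\<And>S j. subtree S \<Longrightarrow> j \<in> V - S \<Longrightarrow> parent j \<in> S \<Longrightarrow> P S \<Longrightarrow> P (insert j S)"
  shows "P S"
  using assms(1)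
proof (induction "card S" arbitrary: S rule: less_induct)
  case less
  have fin: "finite S"
    using less.prems by (rule subtree_finite)
  show ?case
  proof (cases "S = {k}")
    case False
    then have ne: "S - {k} \<noteq> {}"
      using less.prems by (auto simp: subtree_def)
    let ?depth = "\<lambda>j. length (root_path j)"
    have "Max (?depth ` (S - {k})) \<in> ?depth ` (S - {k})"
      using fin ne by (intro Max_in) auto
    then obtain j where max_eq: "Max (?depth ` (S - {k})) = ?depth j" and j: "j \<in> S - {k}"
      by (rule imageE)
    have max: "?depth i \<le> ?depth j" if "i \<in> S - {k}" for i
      using that fin unfolding max_eq[symmetric] by simp
    have "parent i \<noteq> j" if "i \<in> S - {k}" for i
      using max[OF that] length_root_path_parent[of i] less.prems that by (auto simp: subtree_def)
    then have "subtree (S - {j})" "parent j \<in> S - {j}"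
      using less.prems j by (auto simp: subtree_def)
    moreover have "j \<in> V - (S - {j})" "card (S - {j}) < card S"
      using less.prems j fin card_Diff1_less[of S j] by (auto simp: subtree_def)
    ultimately have "P (insert j (S - {j}))"
      using leaf less.hyps by blast
    then show ?thesis
      using j by (simp add: insert_absorb)
  qed (use assms(2) in simp)
qed

text \<open>Each arc on the path to \<open>i\<close> is represented by its head. The root, which is
  the head of no arc, stands for the factor \<open>P\<close>.\<close>

definition ancestors :: "'v \<Rightarrow> 'v set" where
  "ancestors i = insert k (snd ` ph V E k i)"

lemma ancestors_root: "ancestors k = {k}"
  by (simp add: ancestors_def ph_root)

lemma ancestors_parent: "j \<in> V - {k} \<Longrightarrow> ancestors j = insert j (ancestors (parent j))"
  by (auto simp: ancestors_def ph_parent)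

lemma ancestors_subset:
  assumes "subtree S" and "i \<in> S"
  shows "ancestors i \<subseteq> S"
  using assms
proof (induction S arbitrary: i rule: subtree_induct)
  case (leaf S j)
  then have "j \<in> V - {k}"
    by (auto simp: subtree_def)
  with leaf show ?case
    by (cases "i = j") (auto simp: ancestors_parent)
qed (simp add: ancestors_root)

text \<open>
  Along \<open>i\<close>, the vector \<open>x\<close> carries the root value at \<open>k\<close> and the factor of the arc entering \<open>j\<close> at every
  other vertex \<open>j\<close>.
\<close>

definition path_product :: "'v set \<Rightarrow> ('v \<Rightarrow> real) \<Rightarrow> 'v \<Rightarrow> real" where
  "path_product S x = (\<lambda>i\<in>S. \<Prod>j\<in>ancestors i. x j)"

lemma path_product_measurable:
  assumes "subtree S" and "\<And>i. i \<in> S \<Longrightarrow> sets (M i) = sets borel"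
  shows "path_product S \<in> measurable (Pi\<^sub>M S M) (borel_on S)"
  unfolding path_product_def
proof (rule measurable_restrict)
  fix i assume "i \<in> S"
  then have "(\<lambda>x. x j) \<in> borel_measurable (Pi\<^sub>M S M)" if "j \<in> ancestors i" for j
    using ancestors_subset[OF assms(1)] that assms(2)[of j] measurable_component_singleton[of j S M]
    by (auto cong: measurable_cong_sets)
  then show "(\<lambda>x. \<Prod>j\<in>ancestors i. x j) \<in> borel_measurable (Pi\<^sub>M S M)"
    by measurable
qed

text \<open>The ancestors of vertices in \<open>S\<close> stay in \<open>S\<close>, so the new
  factor \<open>u\<close> enters only the coordinate \<open>j\<close>.\<close>

lemma path_product_insert:
  assumes "subtree S" and "j \<in> V - S" and "parent j \<in> S"
  shows "path_product (insert j S) (x(j := u)) =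
    (path_product S x)(j := path_product S x (parent j) * u)"
proof -
  have j: "j \<in> V - {k}"
    using assms by (auto simp: subtree_def)
  have anc: "ancestors i \<subseteq> S" if "i \<in> S" for i
    using ancestors_subset assms that by blast
  have same: "(\<Prod>m\<in>ancestors i. (x(j := u)) m) = (\<Prod>m\<in>ancestors i. x m)" if "i \<in> S" for i
    using anc[OF that] assms by (intro prod.cong) auto
  have "j \<notin> ancestors (parent j)" "finite (ancestors (parent j))"
    using anc assms finite_subset[OF _ subtree_finite] by blast+
  then show ?thesis
    using assms same[OF assms(3)] by (auto simp: fun_eq_iff path_product_def same[simplified] ancestors_parent[OF j])
qed

text \<open>The candidate joint density of the path products when the factor at \<open>j\<close> has
  density \<open>F j\<close>. The reciprocal is the Jacobian of \<open>v = y (parent j) * u\<close>;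
  \<open>ennreal\<close> turns it into 0 when the parent coordinate is not positive.\<close>

definition tree_density :: "('v \<Rightarrow> real \<Rightarrow> ennreal) \<Rightarrow> 'v set \<Rightarrow> ('v \<Rightarrow> real) \<Rightarrow> ennreal" where
  "tree_density F S y =
     F k (y k) * (\<Prod>j\<in>S - {k}. F j (y j / y (parent j)) * ennreal (1 / y (parent j)))"

lemma tree_density_measurable:
  assumes "subtree S" and [measurable]: "\<And>i. F i \<in> borel_measurable borel"
  shows "tree_density F S \<in> borel_measurable (lborel_on S)"
proof -
  have [measurable]: "(\<lambda>y. y i) \<in> borel_measurable (lborel_on S)" if "i \<in> S" for i
    using that measurable_component_singleton[of i S "\<lambda>_. lborel :: real measure"] by simp
  have [measurable]: "(\<lambda>y. y (parent j)) \<in> borel_measurable (lborel_on S)" if "j \<in> S - {k}" for j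
    using that assms(1) by (auto simp: subtree_def)
  have "k \<in> S"
    using assms by (simp add: subtree_def)
  then show ?thesis
    unfolding tree_density_def by measurable
qed

text \<open>A nonzero reciprocal factor already forces the parent coordinate to be positive, and a
  nonzero \<open>F i\<close> forces the quotient to be positive; their product is
  \<open>y i\<close>.\<close>

lemma tree_density_nonzero:
  assumes "tree_density F S y \<noteq> 0" and "finite S" and "i \<in> S"
    and "\<And>i u. u \<le> 0 \<Longrightarrow> F i u = 0"
  shows "0 < y i"
proof (cases "i = k")
  case True
  then show ?thesis
    using assms by (force simp: tree_density_def not_le)
next
  case False
  then have "F i (y i / y (parent i)) \<noteq> 0" "ennreal (1 / y (parent i)) \<noteq> 0"
    using assms(1-3) by (auto simp: tree_density_def)
  then have "0 < y i / y (parent i)" "0 < y (parent i)"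
    using assms(4) by (auto simp: not_le[symmetric] ennreal_eq_0_iff)
  then show ?thesis
    by (simp add: zero_less_divide_iff)
qed

lemma tree_density_insert:
  assumes "subtree S" and "j \<in> V - S" and "parent j \<in> S"
  shows "tree_density F (insert j S) (y(j := v)) =
    tree_density F S y * (F j (v / y (parent j)) * ennreal (1 / y (parent j)))"
proof -
  have j: "j \<noteq> k" "j \<notin> S" "parent j \<noteq> j"
    using assms by (auto simp: subtree_def)
  have *: "(\<Prod>i\<in>S - {k}. F i ((y(j := v)) i / (y(j := v)) (parent i)) * ennreal (1 / (y(j := v)) (parent i))) =
      (\<Prod>i\<in>S - {k}. F i (y i / y (parent i)) * ennreal (1 / y (parent i)))"
    using assms by (intro prod.cong) (auto simp: subtree_def)
  have "insert j S - {k} = insert j (S - {k})"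
    using j by auto
  then show ?thesis
    using * j subtree_finite[OF assms(1)] unfolding tree_density_def
    by (simp add: mult_ac del: fun_upd_apply) (simp add: mult_ac)
qed

text \<open>The test function \<open>h\<close> is arbitrary so that the induction closes:
  integrating out the factor of a new leaf produces another test function, on the smaller
  subtree.\<close>

lemma nn_integral_path_product:
  assumes "subtree S" and F [measurable]: "\<And>i. F i \<in> borel_measurable borel"
    and F0: "\<And>i u. u \<le> 0 \<Longrightarrow> F i u = 0"
    and sf: "product_sigma_finite (\<lambda>i. density lborel (F i))"
    and "h \<in> borel_measurable (borel_on S)"
  shows "(\<integral>\<^sup>+x. h (path_product S x) \<partial>(\<Pi>\<^sub>M i\<in>S. density lborel (F i))) =
    (\<integral>\<^sup>+y. tree_density F S y * h y \<partial>lborel_on S)"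
  using assms(1,5)
proof (induction S arbitrary: h rule: subtree_induct)
  case root
  let ?M = "\<lambda>i. density lborel (F i)"
  interpret F: product_sigma_finite ?M
    by (rule sf)
  interpret L: product_sigma_finite "\<lambda>_ :: 'v. lborel :: real measure"
    by unfold_locales
  have upd: "(\<lambda>x. \<lambda>i\<in>{k}. x) \<in> measurable borel (borel_on {k} :: ('v \<Rightarrow> real) measure)"
    by (intro measurable_restrict) simp
  have [measurable]: "(\<lambda>x. h (\<lambda>i\<in>{k}. x)) \<in> borel_measurable borel"
    using measurable_compose[OF upd root.prems] .
  have "(\<integral>\<^sup>+x. h (path_product {k} x) \<partial>Pi\<^sub>M {k} ?M) = (\<integral>\<^sup>+x. h (\<lambda>i\<in>{k}. x k) \<partial>Pi\<^sub>M {k} ?M)"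
    by (intro nn_integral_cong arg_cong[where f = h]) (auto simp: path_product_def fun_eq_iff ancestors_root)
  also have "\<dots> = (\<integral>\<^sup>+x. h (\<lambda>i\<in>{k}. x) \<partial>?M k)"
    by (rule F.product_nn_integral_singleton) simp
  also have "\<dots> = (\<integral>\<^sup>+x. F k x * h (\<lambda>i\<in>{k}. x) \<partial>lborel)"
    by (rule nn_integral_density) simp_all
  also have "\<dots> = (\<integral>\<^sup>+y. F k (y k) * h (\<lambda>i\<in>{k}. y k) \<partial>lborel_on {k})"
    by (rule L.product_nn_integral_singleton[symmetric]) simp
  also have "\<dots> = (\<integral>\<^sup>+y. tree_density F {k} y * h y \<partial>lborel_on {k})"
  proof (rule nn_integral_cong)
    fix y :: "'v \<Rightarrow> real" assume "y \<in> space (lborel_on {k})"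
    then have "(\<lambda>i\<in>{k}. y k) = y"
      by (auto simp: space_PiM PiE_iff extensional_def fun_eq_iff)
    then show "F k (y k) * h (\<lambda>i\<in>{k}. y k) = tree_density F {k} y * h y"
      by (simp add: tree_density_def)
  qed
  finally show ?case .
next
  case (leaf S j)
  let ?M = "\<lambda>i. density lborel (F i)" and ?S = "insert j S"
  interpret F: product_sigma_finite ?M
    by (rule sf)
  interpret L: product_sigma_finite "\<lambda>_ :: 'v. lborel :: real measure"
    by unfold_locales
  have fin: "finite S" and j: "j \<notin> S" and S: "parent j \<in> S"
    using leaf by (auto simp: subtree_finite)
  have subtree: "subtree ?S"
    using leaf by (auto simp: subtree_def)
  have sets: "sets (lborel_on I) = sets (borel_on I)" for I :: "'v set"
    by (intro sets_PiM_cong) simp_all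
  note [measurable] = leaf.prems
  have [measurable]: "h \<in> borel_measurable (lborel_on ?S)"
    using leaf.prems by (simp cong: measurable_cong_sets add: sets)
  have [measurable]: "tree_density F ?S \<in> borel_measurable (lborel_on ?S)"
    using subtree F by (rule tree_density_measurable)
  have [measurable]: "(\<lambda>y. y (parent j)) \<in> borel_measurable (borel_on S)"
    using S by measurable
  have upd: "(\<lambda>(y, u). y(j := y (parent j) * u)) \<in> measurable (borel_on S \<Otimes>\<^sub>M borel) (borel_on ?S)"
    unfolding split_beta by (intro measurable_fun_upd[where J = S]) auto
  have upd1: "(\<lambda>v. y(j := v)) \<in> measurable borel (borel_on ?S)" if "y \<in> space (borel_on S)" for y :: "'v \<Rightarrow> real"
    using that by (intro measurable_fun_upd[where J = S]) auto
  \<comment> \<open>The test function to which the induction hypothesis is applied.\<close>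
  define H where "H y = (\<integral>\<^sup>+u. h (y(j := y (parent j) * u)) \<partial>?M j)" for y
  have H: "H y = (\<integral>\<^sup>+u. F j u * h (y(j := y (parent j) * u)) \<partial>lborel)" if "y \<in> space (borel_on S)" for y
    unfolding H_def
  proof (rule nn_integral_density)
    show "(\<lambda>u. h (y(j := y (parent j) * u))) \<in> borel_measurable lborel"
      using measurable_compose[OF measurable_Pair2[OF upd that] leaf.prems]
      by (simp del: fun_upd_apply)
  qed simp
  have H_meas: "H \<in> borel_measurable (borel_on S)"
  proof -
    have "(\<lambda>(y, u). h (y(j := y (parent j) * u))) \<in> borel_measurable (borel_on S \<Otimes>\<^sub>M lborel)"
      using measurable_compose[OF upd leaf.prems]
      by (simp add: split_beta cong: measurable_cong_sets)
    then have "(\<lambda>y. \<integral>\<^sup>+u. F j u * h (y(j := y (parent j) * u)) \<partial>lborel) \<in> borel_measurable (borel_on S)"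
      by measurable
    then show ?thesis
      using H by (simp cong: measurable_cong)
  qed
  have "(\<integral>\<^sup>+x. h (path_product ?S x) \<partial>Pi\<^sub>M ?S ?M) =
      (\<integral>\<^sup>+x. (\<integral>\<^sup>+u. h (path_product ?S (x(j := u))) \<partial>?M j) \<partial>Pi\<^sub>M S ?M)"
    using fin j measurable_compose[OF path_product_measurable[OF subtree] leaf.prems]
    by (intro F.product_nn_integral_insert) auto
  also have "\<dots> = (\<integral>\<^sup>+x. H (path_product S x) \<partial>Pi\<^sub>M S ?M)"
    using leaf by (simp add: path_product_insert H_def)
  also have "\<dots> = (\<integral>\<^sup>+y. tree_density F S y * H y \<partial>lborel_on S)"
    by (rule leaf.IH[OF H_meas])
  also have "\<dots> = (\<integral>\<^sup>+y. (\<integral>\<^sup>+v. tree_density F ?S (y(j := v)) * h (y(j := v)) \<partial>lborel) \<partial>lborel_on S)"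
  proof (rule nn_integral_cong)
    fix y assume "y \<in> space (lborel_on S)"
    then have y: "y \<in> space (borel_on S)"
      by (simp add: space_PiM)
    let ?c = "y (parent j)"
    have [measurable]: "(\<lambda>v. h (y(j := v))) \<in> borel_measurable borel"
      using measurable_compose[OF upd1[OF y] leaf.prems] .
    \<comment> \<open>Where the old density vanishes both sides are 0. Elsewhere \<open>?c\<close>
      is positive and \<open>v = ?c * u\<close> may be substituted; the resulting factor
      \<open>?c\<close> cancels the reciprocal in the new density.\<close>
    show "tree_density F S y * H y = (\<integral>\<^sup>+v. tree_density F ?S (y(j := v)) * h (y(j := v)) \<partial>lborel)"
    proof (cases "tree_density F S y = 0")
      case True
      then show ?thesis
        using leaf by (simp add: tree_density_insert)
    next
      case False
      then have c: "0 < ?c"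
        using tree_density_nonzero fin S F0 by blast
      have "(\<integral>\<^sup>+v. tree_density F ?S (y(j := v)) * h (y(j := v)) \<partial>lborel) =
          (\<integral>\<^sup>+v. (tree_density F S y * ennreal (1 / ?c)) * (F j (v / ?c) * h (y(j := v))) \<partial>lborel)"
        using leaf by (simp add: tree_density_insert mult_ac)
      also have "\<dots> = (tree_density F S y * ennreal (1 / ?c)) * (\<integral>\<^sup>+v. F j (v / ?c) * h (y(j := v)) \<partial>lborel)"
        by (rule nn_integral_cmult) simp
      also have "(\<integral>\<^sup>+v. F j (v / ?c) * h (y(j := v)) \<partial>lborel) = ennreal ?c * H y"
        using nn_integral_real_affine[of "\<lambda>v. F j (v / ?c) * h (y(j := v))" ?c 0] c H[OF y] by simp
      also have "tree_density F S y * ennreal (1 / ?c) * (ennreal ?c * H y) =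
          tree_density F S y * (ennreal (1 / ?c) * ennreal ?c) * H y"
        by (simp add: mult_ac)
      also have "ennreal (1 / ?c) * ennreal ?c = 1"
        using c by (simp add: ennreal_mult[symmetric])
      finally show ?thesis
        by (simp del: fun_upd_apply)
    qed
  qed
  also have "\<dots> = (\<integral>\<^sup>+y. tree_density F ?S y * h y \<partial>lborel_on ?S)"
    using fin j by (intro L.product_nn_integral_insert[symmetric]) auto
  finally show ?case .
qed

end

subsection \<open>Homogeneous densities and the standard Pareto law\<close>

text \<open>Each hyperplane is a box with one side of length 0. Hence closed and open orthants are
  interchangeable under integrals.\<close>

lemma AE_PiM_lborel_nonzero:
  assumes "finite I"
  shows "AE z in lborel_on I. \<forall>i\<in>I. z i \<noteq> 0"
proof -
  interpret product_sigma_finite "\<lambda>_. lborel :: real measure"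
    by unfold_locales
  have "AE z in lborel_on I. z i \<noteq> 0" if "i \<in> I" for i
  proof (rule AE_I)
    let ?B = "\<lambda>j. if j = i then {0} else (UNIV :: real set)"
    show "{z \<in> space (lborel_on I). \<not> z i \<noteq> 0} \<subseteq> Pi\<^sub>E I ?B"
      by (auto simp: space_PiM PiE_iff extensional_def)
    show "Pi\<^sub>E I ?B \<in> sets (lborel_on I)"
      using assms by (intro sets_PiM_I_finite) auto
    show "emeasure (lborel_on I) (Pi\<^sub>E I ?B) = 0"
      using assms that by (subst emeasure_PiM) (auto intro!: prod_zero bexI[of _ i])
  qed
  then show ?thesis
    using assms by (simp add: AE_finite_all)
qed

text \<open>One affine substitution per coordinate, each contributing a factor
  \<open>t\<close>.\<close>

lemma nn_integral_PiM_lborel_scale: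
  assumes "finite I" and "0 < t" and "f \<in> borel_measurable (lborel_on I)"
  shows "(\<integral>\<^sup>+z. f z \<partial>lborel_on I) = ennreal (t ^ card I) * (\<integral>\<^sup>+z. f (\<lambda>i\<in>I. t * z i) \<partial>lborel_on I)"
  using assms(1,3)
proof (induction I arbitrary: f rule: finite_induct)
  case empty
  then show ?case
    by (simp add: PiM_empty nn_integral_count_space_finite)
next
  case (insert i I)
  interpret product_sigma_finite "\<lambda>_. lborel :: real measure"
    by unfold_locales
  have [measurable]: "f \<in> borel_measurable (lborel_on (insert i I))"
    by fact
  have upd [measurable]: "(\<lambda>(z, x). z(i := x)) \<in> measurable (lborel_on I \<Otimes>\<^sub>M lborel) (lborel_on (insert i I))"
    unfolding split_beta by (intro measurable_fun_upd[where J = I]) auto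
  have "(\<integral>\<^sup>+z. f z \<partial>lborel_on (insert i I)) = (\<integral>\<^sup>+z. (\<integral>\<^sup>+x. f (z(i := x)) \<partial>lborel) \<partial>lborel_on I)"
    using insert by (simp add: product_nn_integral_insert)
  also have "\<dots> = (\<integral>\<^sup>+z. ennreal t * (\<integral>\<^sup>+x. f (z(i := t * x)) \<partial>lborel) \<partial>lborel_on I)"
  proof (rule nn_integral_cong)
    fix z assume "z \<in> space (lborel_on I)"
    then have [measurable]: "(\<lambda>x. f (z(i := x))) \<in> borel_measurable lborel"
      using measurable_compose[OF measurable_Pair2[OF upd] insert.prems] by (simp add: space_PiM)
    show "(\<integral>\<^sup>+x. f (z(i := x)) \<partial>lborel) = ennreal t * (\<integral>\<^sup>+x. f (z(i := t * x)) \<partial>lborel)"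
      using nn_integral_real_affine[of "\<lambda>x. f (z(i := x))" t 0] \<open>0 < t\<close> by simp
  qed
  also have "\<dots> = ennreal (t ^ card I) *
      (\<integral>\<^sup>+z. ennreal t * (\<integral>\<^sup>+x. f ((\<lambda>l\<in>I. t * z l)(i := t * x)) \<partial>lborel) \<partial>lborel_on I)"
    by (rule insert.IH) measurable
  also have "\<dots> = ennreal (t ^ card (insert i I)) *
      (\<integral>\<^sup>+z. (\<integral>\<^sup>+x. f ((\<lambda>l\<in>I. t * z l)(i := t * x)) \<partial>lborel) \<partial>lborel_on I)"
    using insert.hyps \<open>0 < t\<close>
    by (subst nn_integral_cmult) (measurable, simp add: ennreal_mult mult_ac)
  also have "(\<integral>\<^sup>+z. (\<integral>\<^sup>+x. f ((\<lambda>l\<in>I. t * z l)(i := t * x)) \<partial>lborel) \<partial>lborel_on I) =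
      (\<integral>\<^sup>+z. (\<integral>\<^sup>+x. f (\<lambda>l\<in>insert i I. t * (z(i := x)) l) \<partial>lborel) \<partial>lborel_on I)"
    using insert.hyps by (intro nn_integral_cong arg_cong[where f = f]) (auto simp: fun_eq_iff)
  also have "\<dots> = (\<integral>\<^sup>+z. f (\<lambda>l\<in>insert i I. t * z l) \<partial>lborel_on (insert i I))"
    using insert.hyps by (subst product_nn_integral_insert) auto
  finally show ?case .
qed

text \<open>Continuity refers to functions on the whole index type, measurability to the product
  over \<open>V\<close>. As the index type is countable, the product sigma-algebra over all indices
  is the Borel one, and a point over \<open>V\<close> is a full function with constant
  \<open>undefined\<close> coordinates outside \<open>V\<close>.\<close>

lemma borel_measurable_continuous_on_pos_orthant:
  fixes V :: "'v :: countable set"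
  assumes "finite V" and cont: "continuous_on (pos_orthant V) f"
  shows "(\<lambda>y. ennreal (f y) * indicator (pos_orthant V) y) \<in> borel_measurable (borel_on V)"
proof -
  have "(\<lambda>y. y) \<in> measurable (borel_on V) (\<Pi>\<^sub>M i\<in>(UNIV :: 'v set). (borel :: real measure))"
  proof (rule measurable_PiM_single')
    fix i
    show "(\<lambda>y. y i) \<in> borel_measurable (borel_on V :: ('v \<Rightarrow> real) measure)"
    proof (cases "i \<in> V")
      case False
      then have "(\<lambda>y. y i) \<in> borel_measurable (borel_on V :: ('v \<Rightarrow> real) measure) \<longleftrightarrow>
        (\<lambda>_. undefined :: real) \<in> borel_measurable (borel_on V :: ('v \<Rightarrow> real) measure)"
        by (intro measurable_cong) (auto simp: space_PiM PiE_iff extensional_def)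
      then show ?thesis by simp
    qed simp
  qed (auto simp: space_PiM)
  then have id: "(\<lambda>y. y) \<in> measurable (borel_on V :: ('v \<Rightarrow> real) measure) borel"
    using measurable_cong_sets[OF refl sets_PiM_equal_borel] by blast
  have "pos_orthant V = {y. (\<forall>i\<in>V. 0 < y i) \<and> (\<forall>i\<in>-V. y i = undefined)}"
    by (auto simp: pos_orthant_def PiE_iff extensional_def)
  also have "\<dots> \<in> sets borel"
    using assms by measurable
  finally have "(\<lambda>y. indicat_real (pos_orthant V) y *\<^sub>R f y) \<in> borel_measurable borel"
    using cont by (intro borel_measurable_continuous_on_indicator)
  then have "(\<lambda>y. ennreal (indicat_real (pos_orthant V) y *\<^sub>R f y)) \<in> borel_measurable (borel_on V)"
    by (intro measurable_compose[OF id] measurable_compose[OF _ measurable_ennreal])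
  moreover have "(\<lambda>y. ennreal (indicat_real (pos_orthant V) y *\<^sub>R f y)) =
      (\<lambda>y. ennreal (f y) * indicator (pos_orthant V) y)"
    by (auto simp: fun_eq_iff indicator_def)
  ultimately show "(\<lambda>y. ennreal (f y) * indicator (pos_orthant V) y) \<in> borel_measurable (borel_on V)"
    by simp
qed

section \<open>Homogeneity of the marginals and the extremal densities\<close>

lemma marginal_cong:
  assumes "\<And>i. i \<in> I \<Longrightarrow> y i = y' i"
  shows "marginal V lam I y = marginal V lam I y'"
proof -
  have "merge I J (y, z) = merge I J (y', z)" for J and z :: "_ \<Rightarrow> real"
    using assms by (auto simp: merge_def)
  then show ?thesis
    by (simp add: marginal_def)
qed

text \<open>Restricting to the open orthant makes the integrand measurable and homogeneous.\<close>

lemma marginal_eq_pos_orthant: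
  assumes "finite V" and "I \<subseteq> V" and "\<And>i. i \<in> I \<Longrightarrow> 0 < y i"
  shows "marginal V lam I y = enn2real (\<integral>\<^sup>+z. ennreal (lam (merge I (V - I) (y, z))) *
    indicator (pos_orthant V) (merge I (V - I) (y, z)) \<partial>lborel_on (V - I))"
  unfolding marginal_def
proof (intro arg_cong[where f = enn2real] nn_integral_cong_AE)
  show "AE z in lborel_on (V - I). ennreal (lam (merge I (V - I) (y, z))) *
      indicator (\<Pi>\<^sub>E l\<in>V - I. {0..}) z =
      ennreal (lam (merge I (V - I) (y, z))) * indicator (pos_orthant V) (merge I (V - I) (y, z))"
    using AE_PiM_lborel_nonzero[OF finite_Diff[OF assms(1)], of I] AE_space
  proof eventually_elim
    case (elim z)
    then have "z \<in> (\<Pi>\<^sub>E l\<in>V - I. {0..}) \<longleftrightarrow> merge I (V - I) (y, z) \<in> pos_orthant V"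
      using assms by (force simp: pos_orthant_def PiE_iff merge_def extensional_def space_PiM
          less_le split: if_splits)
    then show ?case
      by (simp add: indicator_def)
  qed
qed

text \<open>Homogeneity of \<open>lam\<close> gives the exponent \<open>-(card V + 1)\<close>, and
  rescaling the \<open>card V - card I\<close> integrated coordinates gives the rest back. If the
  integral is infinite, \<open>enn2real\<close> makes both sides 0.\<close>

lemma marginal_scale:
  fixes V :: "'v :: countable set"
  assumes lam: "exponent_measure_density V lam" and fin: "finite V" and sub: "I \<subseteq> V"
    and t: "0 < t" and y: "\<And>i. i \<in> I \<Longrightarrow> 0 < y i"
  shows "marginal V lam I (\<lambda>i. t * y i) = t powr (- (real (card I) + 1)) * marginal V lam I y"
proof -
  let ?J = "V - I"
  define f where "f x = ennreal (lam x) * indicator (pos_orthant V) x" for x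
  have f_meas: "f \<in> borel_measurable (lborel_on V)"
    using borel_measurable_continuous_on_pos_orthant[OF fin] lam
    by (auto simp: f_def[abs_def] exponent_measure_density_def cong: measurable_cong_sets sets_PiM_cong)
  have f_scale: "f (\<lambda>i\<in>V. t * x i) = ennreal (t powr (- (real (card V) + 1))) * f x"
    if "x \<in> extensional V" for x
  proof -
    have "(\<lambda>i\<in>V. t * x i) \<in> pos_orthant V \<longleftrightarrow> x \<in> pos_orthant V"
      using t that by (auto simp: pos_orthant_def PiE_iff zero_less_mult_iff)
    then show ?thesis
      using lam t by (auto simp: f_def exponent_measure_density_def indicator_def ennreal_mult' )
  qed
  have merge_meas: "(\<lambda>z. merge I ?J (x, z)) \<in> measurable (lborel_on ?J) (lborel_on V)" for x
  proof -
    \<comment> \<open>\<open>x\<close> need not be extensional, hence the restriction to a point of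
      the product space; \<open>merge\<close> reads it only on \<open>I\<close>.\<close>
    have "(\<lambda>z. merge I ?J (restrict x I, z)) \<in> measurable (lborel_on ?J) (lborel_on (I \<union> ?J))"
      by (rule measurable_compose[OF measurable_Pair1' measurable_merge]) (simp add: space_PiM)
    moreover have "merge I ?J (restrict x I, z) = merge I ?J (x, z)" for z
      by (auto simp: merge_def)
    ultimately show ?thesis
      using sub by (simp add: Un_absorb1)
  qed
  have meas: "(\<lambda>z. f (merge I ?J (x, z))) \<in> borel_measurable (lborel_on ?J)" for x
    using measurable_compose[OF merge_meas f_meas] .
  have "(\<integral>\<^sup>+z. f (merge I ?J (\<lambda>i. t * y i, z)) \<partial>lborel_on ?J) =
      ennreal (t ^ card ?J) * (\<integral>\<^sup>+z. f (merge I ?J (\<lambda>i. t * y i, \<lambda>i\<in>?J. t * z i)) \<partial>lborel_on ?J)"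
    using fin t meas by (intro nn_integral_PiM_lborel_scale) auto
  also have "(\<lambda>z. merge I ?J (\<lambda>i. t * y i, \<lambda>i\<in>?J. t * z i)) = (\<lambda>z. \<lambda>i\<in>V. t * merge I ?J (y, z) i)"
    using sub by (auto simp: fun_eq_iff merge_def)
  then have "(\<lambda>z. f (merge I ?J (\<lambda>i. t * y i, \<lambda>i\<in>?J. t * z i))) = (\<lambda>z. f (\<lambda>i\<in>V. t * merge I ?J (y, z) i))"
    by (metis (no_types))
  also have "\<dots> = (\<lambda>z. ennreal (t powr (- (real (card V) + 1))) * f (merge I ?J (y, z)))"
    using sub by (intro ext f_scale) (auto simp: merge_def extensional_def)
  also have "(\<integral>\<^sup>+z. ennreal (t powr (- (real (card V) + 1))) * f (merge I ?J (y, z)) \<partial>lborel_on ?J) =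
      ennreal (t powr (- (real (card V) + 1))) * (\<integral>\<^sup>+z. f (merge I ?J (y, z)) \<partial>lborel_on ?J)"
    by (rule nn_integral_cmult[OF meas])
  finally have *: "(\<integral>\<^sup>+z. f (merge I ?J (\<lambda>i. t * y i, z)) \<partial>lborel_on ?J) =
      ennreal (t ^ card ?J * t powr (- (real (card V) + 1))) * (\<integral>\<^sup>+z. f (merge I ?J (y, z)) \<partial>lborel_on ?J)"
    using t by (simp add: ennreal_mult mult.assoc)
  have "card V = card I + card ?J"
    using fin sub by (simp add: card_Diff_subset card_mono finite_subset)
  then have "t ^ card ?J * t powr (- (real (card V) + 1)) = t powr (- (real (card I) + 1))"
    using t by (simp add: powr_realpow[symmetric] powr_add[symmetric])
  then show ?thesis
    using * t y fin sub by (simp add: marginal_eq_pos_orthant f_def[symmetric] enn2real_mult)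
qed

text \<open>Scaling by \<open>t = y i\<close> normalises the first coordinate to 1; two coordinates
  give the exponent -3.\<close>

lemma marginal_eq_extremal_density:
  fixes V :: "'v :: countable set"
  assumes "exponent_measure_density V lam" and "finite V" and "i \<in> V" "j \<in> V" "i \<noteq> j"
    and "0 < y i" "0 < y j"
  shows "marginal V lam {i, j} y = y i powr (- 3) * extremal_density V lam i j (y j / y i)"
proof -
  let ?y = "\<lambda>l. if l = i then 1 else y j / y i"
  have "marginal V lam {i, j} y = marginal V lam {i, j} (\<lambda>l. y i * ?y l)"
    using assms by (intro marginal_cong) auto
  also have "\<dots> = y i powr (- (real (card {i, j}) + 1)) * marginal V lam {i, j} ?y"
    using assms by (intro marginal_scale) auto
  finally show ?thesis
    using assms by (simp add: extremal_density_def)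
qed

text \<open>The tails from 1 on determine the law: the tail at 1 has full mass, so both distribution
  functions vanish below 1, and above 1 they are complements of equal tails.\<close>

lemma standard_pareto_distr:
  assumes "prob_space N" and P: "standard_pareto N P"
  shows "distr N borel P = density lborel (\<lambda>x. ennreal (x powr (- 2)) * indicator {1<..} x)"
proof -
  interpret N: prob_space N by fact
  let ?D = "density lborel (\<lambda>x. ennreal (x powr (- 2)) * indicator {1<..} x)"
  have [measurable]: "P \<in> borel_measurable N"
    using P by (simp add: standard_pareto_def)
  have tail: "emeasure ?D {a<..} = ennreal (1 / a)" if "1 \<le> a" for a :: real
  proof -
    have "emeasure ?D {a<..} = (\<integral>\<^sup>+x. ennreal (x powr (- 2)) * indicator {a..} x \<partial>lborel)"
      using that AE_lborel_singleton[of a]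
      by (subst emeasure_density) (auto intro!: nn_integral_cong_AE simp: indicator_def elim!: eventually_mono)
    also have "\<dots> = 0 - (- (1 / a))"
    proof (rule nn_integral_FTC_atLeast)
      show "((\<lambda>x :: real. - (1 / x)) \<longlongrightarrow> 0) at_top"
        by real_asymp
      show "DERIV (\<lambda>x. - (1 / x)) x :> x powr - 2" if "a \<le> x" for x
        using that \<open>1 \<le> a\<close>
        by (auto intro!: derivative_eq_intros simp: powr_minus powr_numeral power2_eq_square field_simps)
    qed auto
    finally show ?thesis by simp
  qed
  have D1: "emeasure ?D {..1} = 0"
    by (subst emeasure_density) (auto simp: indicator_def intro!: nn_integral_0_iff_AE[THEN iffD2])
  have "emeasure ?D (space ?D) = emeasure ?D ({..1} \<union> {1<..})"
    by (rule arg_cong[where f = "emeasure ?D"]) auto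
  also have "\<dots> = emeasure ?D {..1} + emeasure ?D {1<..}"
    by (rule plus_emeasure[symmetric]) auto
  finally have "emeasure ?D (space ?D) = 1"
    using D1 tail[of 1] by simp
  then interpret D: prob_space ?D
    by (rule prob_spaceI)
  interpret D: real_distribution ?D
    by unfold_locales auto
  interpret P: real_distribution "distr N borel P"
    by (intro N.real_distribution_distr) simp
  have tail_P: "emeasure (distr N borel P) {a<..} = ennreal (1 / a)" if "1 \<le> a" for a
    using P that by (subst emeasure_distr)
      (auto simp: standard_pareto_def N.emeasure_eq_measure vimage_def Int_def conj_commute)
  have "cdf (distr N borel P) a = cdf ?D a" for a
  proof (cases "1 \<le> a")
    case True
    have "cdf X a = 1 - 1 / a"
      if "real_distribution X" and "emeasure X {a<..} = ennreal (1 / a)" for X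
    proof -
      interpret X: real_distribution X by fact
      have "measure X {a<..} = 1 / a"
        using that True by (simp add: measure_def)
      moreover have "{..a} = space X - {a<..}"
        by auto
      ultimately show ?thesis
        using X.prob_compl[of "{a<..}"] by (simp add: cdf_def)
    qed
    with True show ?thesis
      using tail tail_P P.real_distribution_axioms D.real_distribution_axioms by metis
  next
    case False
    have "cdf X a = 0"
      if "real_distribution X" and "emeasure X {1<..} = ennreal (1 / 1)" for X
    proof -
      interpret X: real_distribution X by fact
      have "measure X {1<..} = 1"
        using that by (simp add: measure_def)
      moreover have "{..1} = space X - {1<..}"
        by auto
      ultimately have "measure X {..1} = 0"
        using X.prob_compl[of "{1<..}"] by simp
      moreover have "measure X {..a} \<le> measure X {..1}"
        using False by (intro X.finite_measure_mono) auto
      ultimately show ?thesis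
        by (simp add: cdf_def measure_le_0_iff)
    qed
    then show ?thesis
      using tail tail_P P.real_distribution_axioms D.real_distribution_axioms by (metis order_refl)
  qed
  then show ?thesis
    by (intro cdf_unique P.real_distribution_axioms D.real_distribution_axioms ext)
qed

subsection \<open>The conditioned Pareto vector\<close>

lemma pos_orthant_in_L_space:
  assumes "finite V" and "k \<in> V" and "y \<in> pos_orthant V" and "1 < y k"
  shows "y \<in> L_space V"
proof -
  have "y \<in> (\<Pi>\<^sub>E i\<in>V. {0..})"
    using assms(3) by (auto simp: pos_orthant_def PiE_iff less_imp_le)
  moreover have "y \<noteq> (\<lambda>i\<in>V. 0)"
    using assms by auto
  moreover have "\<bar>y k\<bar> \<le> Max ((\<lambda>i. \<bar>y i\<bar>) ` V)"
    using assms by (intro Max_ge imageI) auto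
  ultimately show ?thesis
    using assms(4) by (auto simp: L_space_def E_space_def)
qed

text \<open>
  If \<open>\<Lambda>(1)\<close> were \<open>0\<close>, possibly as the junk value of an infinite integral, division by zero would make
  the density of \<open>Y\<close> vanish.
\<close>

lemma Lambda_one_pos:
  assumes "prob_space M" and "multivariate_pareto V lam M Y"
  shows "0 < Lambda_one V lam"
proof -
  interpret prob_space M by fact
  have "Y \<in> measurable M (lborel_on V)"
    and distr: "distr M (lborel_on V) Y = density (lborel_on V) (\<lambda>y. ennreal (pareto_density V lam y))"
    using assms by (auto simp: multivariate_pareto_def distributed_def)
  then interpret D: prob_space "density (lborel_on V) (\<lambda>y. ennreal (pareto_density V lam y))"
    using prob_space_distr[of Y "lborel_on V"] by simp
  have "Lambda_one V lam \<noteq> 0"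
  proof
    assume "Lambda_one V lam = 0"
    then have "(\<lambda>y. ennreal (pareto_density V lam y)) = (\<lambda>_. 0)"
      by (simp add: pareto_density_def fun_eq_iff)
    then show False
      using D.emeasure_space_1 by (simp add: emeasure_density)
  qed
  then show ?thesis
    by (simp add: Lambda_one_def less_le)
qed

text \<open>By (L2) for the index \<open>k\<close>, the conditioning event has probability
  \<open>1 / Lambda_one V lam\<close>. Conditioning divides by this constant, which is positive and
  finite, and so leaves \<open>lam\<close> itself.\<close>

lemma distr_conditional_pareto:
  fixes V :: "'v :: countable set"
  assumes "finite V" and k: "k \<in> V" and M: "prob_space M" and Y: "multivariate_pareto V lam M Y"
  shows "distr (uniform_measure M {w \<in> space M. Y w k > 1}) (borel_on V) Y =
    density (lborel_on V) (\<lambda>y. ennreal (lam y) * indicator {y \<in> pos_orthant V. 1 < y k} y)"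
    (is "distr (uniform_measure M ?B) _ Y = density _ ?q")
proof -
  interpret prob_space M by fact
  let ?pd = "\<lambda>y. ennreal (pareto_density V lam y)" and ?c = "ennreal (1 / Lambda_one V lam)"
  let ?C = "{y \<in> space (lborel_on V). 1 < y k}"
  have lam: "exponent_measure_density V lam"
    and Y_meas: "Y \<in> measurable M (lborel_on V)"
    and distr: "distr M (lborel_on V) Y = density (lborel_on V) ?pd"
    and pd_meas: "?pd \<in> borel_measurable (lborel_on V)"
    using Y by (auto simp: multivariate_pareto_def distributed_def)
  have sets: "sets (lborel_on V) = sets (borel_on V)"
    by (intro sets_PiM_cong) simp_all
  have [measurable]: "(\<lambda>y. y k) \<in> borel_measurable (lborel_on V)"
    using measurable_component_singleton[of k V "\<lambda>_. lborel :: real measure"] k by simp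
  have C: "?C \<in> sets (lborel_on V)"
    by measurable
  have "(\<lambda>y. ennreal (lam y) * indicator (pos_orthant V) y) \<in> borel_measurable (lborel_on V)"
    using borel_measurable_continuous_on_pos_orthant[OF \<open>finite V\<close>, of lam] lam
    by (simp add: exponent_measure_density_def sets cong: measurable_cong_sets)
  then have "(\<lambda>y. ennreal (lam y) * indicator (pos_orthant V) y * indicator ?C y) \<in> borel_measurable (lborel_on V)"
    by (rule borel_measurable_times_ennreal) (use C in auto)
  also have "(\<lambda>y. ennreal (lam y) * indicator (pos_orthant V) y * indicator ?C y) = ?q"
    by (auto simp: fun_eq_iff indicator_def pos_orthant_def space_PiM PiE_iff)
  finally have q_meas: "?q \<in> borel_measurable (lborel_on V)" .
  have Lam: "0 < Lambda_one V lam"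
    using M Y by (rule Lambda_one_pos)
  have pd: "?pd y * indicator ?C y = ?c * ?q y" if "y \<in> space (lborel_on V)" for y
  proof (cases "y \<in> pos_orthant V \<and> 1 < y k")
    case True
    then have "y \<in> L_space V" "0 < lam y"
      using pos_orthant_in_L_space[OF \<open>finite V\<close> k, of y] lam by (auto simp: exponent_measure_density_def)
    with True that Lam show ?thesis
      by (simp add: pareto_density_def ennreal_mult[symmetric])
  qed (auto simp: pareto_density_def indicator_def)
  have law: "emeasure M (?B \<inter> (Y -` A \<inter> space M)) = ?c * emeasure (density (lborel_on V) ?q) A"
    if A: "A \<in> sets (lborel_on V)" for A
  proof -
    have "?B \<inter> (Y -` A \<inter> space M) = Y -` (?C \<inter> A) \<inter> space M"
      using measurable_space[OF Y_meas] by auto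
    then have "emeasure M (?B \<inter> (Y -` A \<inter> space M)) = emeasure (density (lborel_on V) ?pd) (?C \<inter> A)"
      using A C Y_meas by (simp add: distr[symmetric] emeasure_distr)
    also have "\<dots> = (\<integral>\<^sup>+y. ?pd y * indicator ?C y * indicator A y \<partial>lborel_on V)"
      using A C pd_meas by (simp add: emeasure_density indicator_inter_arith mult.assoc)
    also have "\<dots> = (\<integral>\<^sup>+y. ?c * (?q y * indicator A y) \<partial>lborel_on V)"
      by (intro nn_integral_cong) (simp only: pd mult.assoc)
    also have "\<dots> = ?c * emeasure (density (lborel_on V) ?q) A"
      using A q_meas by (simp add: nn_integral_cmult emeasure_density)
    finally show ?thesis .
  qed
  have "emeasure (density (lborel_on V) ?q) (space (lborel_on V)) = (\<integral>\<^sup>+y. ?q y \<partial>lborel_on V)"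
    using q_meas by (subst emeasure_density) (auto intro!: nn_integral_cong)
  \<comment> \<open>(L2) integrates over a set that includes boundary faces, which are null.\<close>
  also have "\<dots> = (\<integral>\<^sup>+y \<in> {y \<in> E_space V. y k > 1}. ennreal (lam y) \<partial>lborel_on V)"
  proof (rule nn_integral_cong_AE)
    show "AE y in lborel_on V. ?q y = ennreal (lam y) * indicator {y \<in> E_space V. y k > 1} y"
      using AE_PiM_lborel_nonzero[OF \<open>finite V\<close>] AE_space
    proof eventually_elim
      case (elim y)
      then have "y \<in> pos_orthant V \<and> 1 < y k \<longleftrightarrow> y \<in> E_space V \<and> 1 < y k"
        using k by (auto simp: pos_orthant_def E_space_def PiE_iff space_PiM less_le)
      then show ?case
        by (simp add: indicator_def)
    qed
  qed
  also have "\<dots> = 1"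
    using lam k by (simp add: exponent_measure_density_def)
  finally have total: "emeasure (density (lborel_on V) ?q) (space (lborel_on V)) = 1" .
  have B: "?B \<in> sets M"
    using measurable_sets[OF Y_meas C] measurable_space[OF Y_meas] by (auto simp: vimage_def Int_def conj_commute cong: conj_cong)
  have "?B \<inter> (Y -` space (lborel_on V) \<inter> space M) = ?B"
    using measurable_space[OF Y_meas] by auto
  then have B_law: "emeasure M ?B = ?c"
    using law[of "space (lborel_on V)"] total by simp
  show ?thesis
  proof (rule measure_eqI)
    fix A assume "A \<in> sets (distr (uniform_measure M ?B) (borel_on V) Y)"
    then have A: "A \<in> sets (lborel_on V)"
      by (simp add: sets)
    have Y': "Y \<in> measurable (uniform_measure M ?B) (borel_on V)"
      using Y_meas sets by (simp cong: measurable_cong_sets)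
    have "emeasure (distr (uniform_measure M ?B) (borel_on V) Y) A = emeasure (uniform_measure M ?B) (Y -` A \<inter> space M)"
      using A sets Y' by (subst emeasure_distr) simp_all
    also have "\<dots> = ?c * emeasure (density (lborel_on V) ?q) A / ?c"
      using A B Y_meas by (simp add: law B_law measurable_sets)
    also have "\<dots> = emeasure (density (lborel_on V) ?q) A * (?c / ?c)"
      unfolding ennreal_times_divide by (simp only: mult.commute)
    also have "?c / ?c = 1"
      using Lam by (intro ennreal_divide_self) (auto simp: ennreal_eq_0_iff not_le)
    finally show "emeasure (distr (uniform_measure M ?B) (borel_on V) Y) A = emeasure (density (lborel_on V) ?q) A"
      by simp
  qed (simp add: sets)
qed

section \<open>Independent root and arc variables, indexed by vertices\<close>

context rooted_tree
begin

text \<open>A box event splits into an event of \<open>P\<close> and a box event of the arc family,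
  which are independent; the latter factorizes by independence of the arc variables. Boxes determine
  the product measure.\<close>

lemma distr_root_arcs:
  assumes N: "prob_space N" and indep: "prob_space.indep_vars N (\<lambda>_. borel) U (oriented_edges V E k)"
    and indep_root: "indep_rv N borel P (borel_on (oriented_edges V E k)) (\<lambda>w. \<lambda>e\<in>oriented_edges V E k. U e w)"
  defines "X \<equiv> \<lambda>i. if i = k then P else U (parent i, i)"
  shows "(\<lambda>w. \<lambda>i\<in>V. X i w) \<in> measurable N (borel_on V)"
    and "distr N (borel_on V) (\<lambda>w. \<lambda>i\<in>V. X i w) = (\<Pi>\<^sub>M i\<in>V. distr N borel (X i))"
proof -
  interpret prob_space N by fact
  let ?O = "oriented_edges V E k" and ?U = "\<lambda>w. \<lambda>e\<in>oriented_edges V E k. U e w"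
  have U_meas: "U e \<in> borel_measurable N" if "e \<in> ?O" for e
    using indep that by (auto simp: indep_vars_def)
  have P_meas: "P \<in> borel_measurable N"
    using indep_root by (simp add: indep_rv_def)
  have X_meas: "X i \<in> borel_measurable N" if "i \<in> V" for i
    using that U_meas P_meas by (auto simp: X_def oriented_edges_iff)
  show meas: "(\<lambda>w. \<lambda>i\<in>V. X i w) \<in> measurable N (borel_on V)"
    by (intro measurable_restrict X_meas)
  have fin: "finite ?O"
    using bij_betw_finite[OF bij_betw_snd] finite_V by simp
  \<comment> \<open>A point mass fills the indices outside \<open>V\<close>, because a sigma-finite
    measure is required at every index.\<close>
  define X' where "X' i = (if i \<in> V then distr N borel (X i) else return borel 0)" for i
  have "prob_space (X' i)" for i
    by (simp add: X'_def prob_space_distr X_meas prob_space_return)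
  then interpret X': product_sigma_finite X'
    by (simp add: product_sigma_finite_def prob_space_imp_sigma_finite)
  have "distr N (borel_on V) (\<lambda>w. \<lambda>i\<in>V. X i w) = Pi\<^sub>M V X'"
  proof (rule X'.PiM_eqI)
    show "sets (distr N (borel_on V) (\<lambda>w. \<lambda>i\<in>V. X i w)) = sets (Pi\<^sub>M V X')"
      by (auto simp: X'_def intro!: sets_PiM_cong)
  next
    fix A assume "\<And>i. i \<in> V \<Longrightarrow> A i \<in> sets (X' i)"
    then have A: "\<And>i. i \<in> V \<Longrightarrow> A i \<in> sets borel"
      by (simp add: X'_def)
    define box where "box = Pi\<^sub>E ?O (\<lambda>e. A (snd e))"
    have box: "box \<in> sets (borel_on ?O)"
      unfolding box_def using fin A by (intro sets_PiM_I_finite) (auto simp: oriented_edges_iff)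
    have "(\<lambda>w. \<lambda>i\<in>V. X i w) -` Pi\<^sub>E V A \<inter> space N = (P -` A k \<inter> space N) \<inter> (?U -` box \<inter> space N)"
    proof -
      have "?O = (\<lambda>i. (parent i, i)) ` (V - {k})"
        by (auto simp: oriented_edges_iff)
      then have "(\<forall>i\<in>V. X i w \<in> A i) \<longleftrightarrow> P w \<in> A k \<and> (\<forall>e\<in>?O. U e w \<in> A (snd e))" for w
        using root by (auto simp: X_def)
      then show ?thesis
        by (simp add: box_def set_eq_iff Pi_iff conj_ac)
    qed
    then have "prob ((\<lambda>w. \<lambda>i\<in>V. X i w) -` Pi\<^sub>E V A \<inter> space N) =
        prob (P -` A k \<inter> space N) * prob (?U -` box \<inter> space N)"
      using indep_root box A[OF root] unfolding indep_rv_def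
      by (auto intro!: indep_setD)
    also have "prob (?U -` box \<inter> space N) = (\<Prod>e\<in>?O. prob (U e -` A (snd e) \<inter> space N))"
    proof (cases "?O = {}")
      \<comment> \<open>Here \<open>V = {k}\<close>. An intersection over no arcs would be
        \<open>UNIV\<close> instead of the sample space, so this case is treated apart.\<close>
      case True
      then show ?thesis
        by (simp add: box_def prob_space vimage_def restrict_def)
    next
      case False
      have "?U -` box \<inter> space N = (\<Inter>e\<in>?O. U e -` A (snd e) \<inter> space N)"
      proof (rule set_eqI)
        fix w
        have "w \<in> ?U -` box \<longleftrightarrow> (\<forall>e\<in>?O. w \<in> U e -` A (snd e))"
          by (simp only: box_def vimage_eq restrict_PiE_iff)
        with False show "w \<in> ?U -` box \<inter> space N \<longleftrightarrow> w \<in> (\<Inter>e\<in>?O. U e -` A (snd e) \<inter> space N)"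
          by (simp only: Int_iff INT_iff) blast
      qed
      also have "prob \<dots> = (\<Prod>e\<in>?O. prob (U e -` A (snd e) \<inter> space N))"
        using False fin A by (intro indep_varsD_finite[OF indep]) (auto simp: oriented_edges_iff)
      finally show ?thesis .
    qed
    also have "\<dots> = (\<Prod>e\<in>?O. prob (X (snd e) -` A (snd e) \<inter> space N))"
      by (intro prod.cong) (auto simp: X_def oriented_edges_iff)
    also have "\<dots> = (\<Prod>i\<in>V - {k}. prob (X i -` A i \<inter> space N))"
      by (rule prod.reindex_bij_betw[OF bij_betw_snd])
    also have "prob (P -` A k \<inter> space N) * (\<Prod>i\<in>V - {k}. prob (X i -` A i \<inter> space N)) =
        (\<Prod>i\<in>V. prob (X i -` A i \<inter> space N))"
      using root finite_V by (simp add: prod.remove[of V k] X_def)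
    finally have "emeasure N ((\<lambda>w. \<lambda>i\<in>V. X i w) -` Pi\<^sub>E V A \<inter> space N) =
        (\<Prod>i\<in>V. emeasure N (X i -` A i \<inter> space N))"
      by (simp only: emeasure_eq_measure prod_ennreal measure_nonneg)
    moreover have "Pi\<^sub>E V A \<in> sets (borel_on V)"
      using finite_V A by (intro sets_PiM_I_finite)
    ultimately show "emeasure (distr N (borel_on V) (\<lambda>w. \<lambda>i\<in>V. X i w)) (Pi\<^sub>E V A) = (\<Prod>i\<in>V. emeasure (X' i) (A i))"
      using meas A X_meas by (simp add: emeasure_distr X'_def)
  qed (rule finite_V)
  then show "distr N (borel_on V) (\<lambda>w. \<lambda>i\<in>V. X i w) = (\<Pi>\<^sub>M i\<in>V. distr N borel (X i))"
    by (simp add: X'_def cong: PiM_cong)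
qed

text \<open>Heads are injective on oriented arcs, so a product over ancestors other than
  \<open>k\<close> is a product over the arcs of the path; \<open>k\<close> supplies
  \<open>p\<close>.\<close>

lemma path_product_arcs:
  assumes "i \<in> V"
  shows "path_product V (\<lambda>i\<in>V. if i = k then p else u (parent i, i)) i =
    (if i = k then p else p * (\<Prod>e\<in>ph V E k i. u e))"
proof -
  let ?x = "\<lambda>i\<in>V. if i = k then p else u (parent i, i)"
  have sub: "ph V E k i \<subseteq> oriented_edges V E k"
    using assms by (rule ph_subset)
  have fin: "finite (ph V E k i)"
    using sub bij_betw_finite[OF bij_betw_snd] finite_V by (auto intro: finite_subset)
  have "(\<Prod>j\<in>snd ` ph V E k i. ?x j) = (\<Prod>e\<in>ph V E k i. ?x (snd e))"
    using inj_on_subset[OF bij_betw_imp_inj_on[OF bij_betw_snd] sub] by (simp add: prod.reindex)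
  also have "\<dots> = (\<Prod>e\<in>ph V E k i. u e)"
    by (intro prod.cong) (auto simp: oriented_edges_iff dest!: subsetD[OF sub])
  finally have *: "(\<Prod>j\<in>snd ` ph V E k i. ?x j) = (\<Prod>e\<in>ph V E k i. u e)" .
  have "k \<notin> snd ` ph V E k i"
    by (auto simp: oriented_edges_iff dest!: subsetD[OF sub])
  then have "(\<Prod>j\<in>ancestors i. ?x j) = p * (\<Prod>e\<in>ph V E k i. u e)"
    using fin * root by (simp add: ancestors_def)
  then show ?thesis
    using assms by (auto simp: path_product_def ph_root)
qed

end

section \<open>From the factorization to the density of the path products\<close>

lemma pareto_density_eq_tree_product:
  fixes V :: "'v :: countable set" and E k
  assumes tree: "rooted_tree V E k"
    and lam: "exponent_measure_density V lam" and fac: "factorizes V E lam"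
    and Lam: "0 < Lambda_one V lam" and y: "y \<in> pos_orthant V" "1 < y k"
  shows "lam y = y k powr (- 2) *
    (\<Prod>j\<in>V - {k}. let i = rooted_tree.parent V E k j in extremal_density V lam i j (y j / y i) * (1 / y i))"
proof -
  interpret rooted_tree V E k
    by (rule tree)
  have L: "y \<in> L_space V"
    using finite_V root y by (rule pos_orthant_in_L_space)
  have pos: "0 < y i" if "i \<in> V" for i
    using y that by (auto simp: pos_orthant_def)
  have "lam y / Lambda_one V lam = 1 / Lambda_one V lam *
      (\<Prod>e\<in>E. marginal V lam e y / (\<Prod>i\<in>e. y i powr (- 2))) * (\<Prod>i\<in>V. y i powr (- 2))"
    using bspec[OF fac[unfolded factorizes_def], of y] y L by (simp add: pareto_density_def)
  then have "lam y = (\<Prod>e\<in>E. marginal V lam e y / (\<Prod>i\<in>e. y i powr (- 2))) * (\<Prod>i\<in>V. y i powr (- 2))"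
    using Lam by (simp add: field_simps)
  also have "(\<Prod>e\<in>E. marginal V lam e y / (\<Prod>i\<in>e. y i powr (- 2))) =
      (\<Prod>j\<in>V - {k}. marginal V lam {parent j, j} y / (\<Prod>i\<in>{parent j, j}. y i powr (- 2)))"
    using prod.reindex_bij_betw[OF bij_betw_parent_edge,
        where g = "\<lambda>e. marginal V lam e y / (\<Prod>i\<in>e. y i powr (- 2))"] by simp
  \<comment> \<open>The power of each non-root vertex goes to the arc entering it; the power of the
    root remains.\<close>
  also have "(\<Prod>i\<in>V. y i powr (- 2)) = y k powr (- 2) * (\<Prod>j\<in>V - {k}. y j powr (- 2))"
    using root finite_V by (rule prod.remove[rotated])
  also have "(\<Prod>j\<in>V - {k}. marginal V lam {parent j, j} y / (\<Prod>i\<in>{parent j, j}. y i powr (- 2))) *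
      (y k powr (- 2) * (\<Prod>j\<in>V - {k}. y j powr (- 2))) =
      y k powr (- 2) * (\<Prod>j\<in>V - {k}. marginal V lam {parent j, j} y /
        (\<Prod>i\<in>{parent j, j}. y i powr (- 2)) * y j powr (- 2))"
    by (simp only: prod.distrib mult.left_commute mult.assoc mult.commute)
  also have "(\<Prod>j\<in>V - {k}. marginal V lam {parent j, j} y /
        (\<Prod>i\<in>{parent j, j}. y i powr (- 2)) * y j powr (- 2)) =
      (\<Prod>j\<in>V - {k}. extremal_density V lam (parent j) j (y j / y (parent j)) * (1 / y (parent j)))"
  proof (rule prod.cong[OF refl])
    fix j assume j: "j \<in> V - {k}"
    let ?i = "parent j"
    have i: "?i \<in> V" "?i \<noteq> j"
      using parent_in[OF j] length_root_path_parent[OF j] by auto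
    have "marginal V lam {?i, j} y = y ?i powr (- 3) * extremal_density V lam ?i j (y j / y ?i)"
      using lam finite_V i j pos by (intro marginal_eq_extremal_density) auto
    moreover have "y ?i powr (- 3) / (y ?i powr (- 2) * y j powr (- 2)) * y j powr (- 2) = 1 / y ?i"
      using pos[of j] pos[of ?i] i j by (simp add: powr_minus powr_numeral power2_eq_square power3_eq_cube field_simps)
    moreover have "(\<Prod>l\<in>{?i, j}. y l powr (- 2)) = y ?i powr (- 2) * y j powr (- 2)"
      using i by simp
    moreover have "a * e / b * c = e * (a / b * c)" for a b c e :: real
      by simp
    ultimately show "marginal V lam {?i, j} y / (\<Prod>i\<in>{?i, j}. y i powr (- 2)) * y j powr (- 2) =
        extremal_density V lam ?i j (y j / y ?i) * (1 / y ?i)"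
      by (simp only:)
  qed
  finally show ?thesis
    by (simp add: Let_def)
qed

theorem proposition2:
  fixes d k :: nat
    and V :: "nat set"
    and E :: "nat set set"
    and lam :: "(nat \<Rightarrow> real) \<Rightarrow> real"
    and M :: "'a measure" and Y :: "'a \<Rightarrow> nat \<Rightarrow> real"
    and N :: "'b measure" and U :: "nat \<times> nat \<Rightarrow> 'b \<Rightarrow> real" and P :: "'b \<Rightarrow> real"
  assumes "2 \<le> d" and "V = {1..d}"
    and "undirected_tree V E"
    and "prob_space M" and "multivariate_pareto V lam M Y" and "factorizes V E lam"
    and "k \<in> V"
    and "prob_space N"
    and "\<And>i j. (i, j) \<in> oriented_edges V E k \<Longrightarrow>
           distributed N lborel (U (i, j)) (\<lambda>u. ennreal (extremal_density V lam i j u))"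
    and "prob_space.indep_vars N (\<lambda>_. borel) U (oriented_edges V E k)"
    and "standard_pareto N P"
    and "indep_rv N borel P (borel_on (oriented_edges V E k)) (\<lambda>w. \<lambda>e\<in>oriented_edges V E k. U e w)"
  shows "distr (uniform_measure M {w \<in> space M. Y w k > 1}) (borel_on V) Y =
         distr N (borel_on V)
           (\<lambda>w. \<lambda>i\<in>V. if i = k then P w else P w * (\<Prod>e\<in>ph V E k i. U e w))"
proof -
  note U = assms(9)
  have finite_V: "finite V"
    using assms(2) by simp
  interpret rooted_tree V E k
    using assms(3,7) finite_V by unfold_locales
  have lam: "exponent_measure_density V lam"
    using assms(5) by (simp add: multivariate_pareto_def)
  have Lam: "0 < Lambda_one V lam"
    using assms(4,5) by (rule Lambda_one_pos)
  let ?pareto = "\<lambda>x. ennreal (x powr (- 2)) * indicator {1<..} x"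
  \<comment> \<open>The Pareto density is also used outside \<open>V\<close>, so that every
    \<open>F i\<close> is a probability density, as the product over all indices demands.\<close>
  define F where "F i = (if i \<in> V - {k} then \<lambda>u. ennreal (extremal_density V lam (parent i) i u) else ?pareto)" for i
  define X where "X i = (if i = k then P else U (parent i, i))" for i
  have arc: "distributed N lborel (U (parent i, i)) (F i)" if "i \<in> V - {k}" for i
    using U[of "parent i" i] that by (simp add: oriented_edges_iff F_def)
  have F_meas: "F i \<in> borel_measurable borel" for i
  proof (cases "i \<in> V - {k}")
    case True
    then show ?thesis
      using arc[OF True] by (simp add: distributed_def)
  qed (auto simp: F_def)
  have F_zero: "F i u = 0" if "u \<le> 0" for i u
    using that by (simp add: F_def extremal_density_def)
  have pareto: "distr N borel P = density lborel ?pareto"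
    using assms(8,11) by (rule standard_pareto_distr)
  have F_law: "distr N borel (X i) = density lborel (F i)" if "i \<in> V" for i
  proof (cases "i = k")
    case False
    with arc[of i] that show ?thesis
      by (simp add: X_def distributed_def cong: distr_cong)
  qed (simp add: X_def F_def pareto)
  interpret N: prob_space N
    by fact
  have P_meas: "P \<in> borel_measurable N"
    using assms(11) by (simp add: standard_pareto_def)
  \<comment> \<open>Total mass 1 is not computed for extremal densities: each is the law of some arc
    variable.\<close>
  have "prob_space (density lborel (F i))" for i
  proof (cases "i \<in> V - {k}")
    case True
    then show ?thesis
      using F_law[of i] arc[OF True] N.prob_space_distr[of "X i" borel] by (simp add: X_def distributed_def)
  next
    case False
    then have "F i = ?pareto"
      by (auto simp: F_def)
    then show ?thesis
      using N.prob_space_distr[OF P_meas] by (simp add: pareto)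
  qed
  then have sf: "product_sigma_finite (\<lambda>i. density lborel (F i))"
    by (simp add: product_sigma_finite_def prob_space_imp_sigma_finite)
  have joint: "distr N (borel_on V) (\<lambda>w. \<lambda>i\<in>V. X i w) = (\<Pi>\<^sub>M i\<in>V. density lborel (F i))"
    and X_meas: "(\<lambda>w. \<lambda>i\<in>V. X i w) \<in> measurable N (borel_on V)"
    using distr_root_arcs[OF assms(8,10,12)] F_law by (simp_all add: X_def cong: PiM_cong)
  have path_meas: "path_product V \<in> measurable (borel_on V) (borel_on V)"
    by (rule path_product_measurable[OF subtree_V]) simp
  have path_meas': "path_product V \<in> measurable (\<Pi>\<^sub>M i\<in>V. density lborel (F i)) (borel_on V)"
    by (rule path_product_measurable[OF subtree_V]) simp
  have sets: "sets (lborel_on V) = sets (borel_on V)"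
    by (intro sets_PiM_cong) simp_all
  have "(\<lambda>w. \<lambda>i\<in>V. if i = k then P w else P w * (\<Prod>e\<in>ph V E k i. U e w)) =
      (\<lambda>w. path_product V (\<lambda>i\<in>V. X i w))"
  proof (intro ext)
    fix w i
    have "(\<lambda>i\<in>V. X i w) = (\<lambda>i\<in>V. if i = k then P w else U (parent i, i) w)"
      by (auto simp: X_def)
    then show "(\<lambda>i\<in>V. if i = k then P w else P w * (\<Prod>e\<in>ph V E k i. U e w)) i =
        path_product V (\<lambda>i\<in>V. X i w) i"
      using path_product_arcs[of i "P w" "\<lambda>e. U e w"]
      by (cases "i \<in> V") (auto simp: path_product_def)
  qed
  then have "distr N (borel_on V) (\<lambda>w. \<lambda>i\<in>V. if i = k then P w else P w * (\<Prod>e\<in>ph V E k i. U e w)) =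
      distr (\<Pi>\<^sub>M i\<in>V. density lborel (F i)) (borel_on V) (path_product V)"
    using distr_distr[OF path_meas X_meas] by (simp add: comp_def joint)
  also have "\<dots> = density (lborel_on V) (tree_density F V)"
  proof (rule measure_eqI)
    fix A assume "A \<in> sets (distr (\<Pi>\<^sub>M i\<in>V. density lborel (F i)) (borel_on V) (path_product V))"
    then have A: "A \<in> sets (borel_on V)"
      by simp
    have "emeasure (distr (\<Pi>\<^sub>M i\<in>V. density lborel (F i)) (borel_on V) (path_product V)) A =
        (\<integral>\<^sup>+y. indicator A y \<partial>distr (\<Pi>\<^sub>M i\<in>V. density lborel (F i)) (borel_on V) (path_product V))"
      using A by simp
    also have "\<dots> = (\<integral>\<^sup>+x. indicator A (path_product V x) \<partial>(\<Pi>\<^sub>M i\<in>V. density lborel (F i)))"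
      using A path_meas' by (intro nn_integral_distr) auto
    also have "\<dots> = (\<integral>\<^sup>+y. tree_density F V y * indicator A y \<partial>lborel_on V)"
      using A by (intro nn_integral_path_product subtree_V F_meas F_zero sf borel_measurable_indicator)
    also have "\<dots> = emeasure (density (lborel_on V) (tree_density F V)) A"
      using A tree_density_measurable[OF subtree_V F_meas] by (simp add: emeasure_density sets)
    finally show "emeasure (distr (\<Pi>\<^sub>M i\<in>V. density lborel (F i)) (borel_on V) (path_product V)) A =
        emeasure (density (lborel_on V) (tree_density F V)) A" .
  qed (simp add: sets)
  also have "\<dots> = density (lborel_on V) (\<lambda>y. ennreal (lam y) * indicator {y \<in> pos_orthant V. 1 < y k} y)"
  proof (rule density_cong)
    show "AE y in lborel_on V. tree_density F V y = ennreal (lam y) * indicator {y \<in> pos_orthant V. 1 < y k} y"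
      using AE_space
    proof eventually_elim
      case (elim y)
      show ?case
      proof (cases "y \<in> pos_orthant V \<and> 1 < y k")
        case True
        have nonneg: "0 \<le> extremal_density V lam i j u" for i j u
          by (simp add: extremal_density_def marginal_def)
        have inv: "0 \<le> 1 / y (parent j)" if "j \<in> V - {k}" for j
          using True parent_in[OF that] by (auto simp: pos_orthant_def PiE_iff less_imp_le)
        let ?factor = "\<lambda>j. extremal_density V lam (parent j) j (y j / y (parent j)) * (1 / y (parent j))"
        have "tree_density F V y = ennreal (y k powr (- 2)) * (\<Prod>j\<in>V - {k}. ennreal (?factor j))"
          unfolding tree_density_def using True inv nonneg
          by (intro arg_cong2[where f = "(*)"] prod.cong) (simp_all add: F_def ennreal_mult[symmetric])
        also have "\<dots> = ennreal (y k powr (- 2) * (\<Prod>j\<in>V - {k}. ?factor j))"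
          using inv nonneg
          by (subst prod_ennreal) (auto intro!: ennreal_mult[symmetric] mult_nonneg_nonneg prod_nonneg simp del: times_divide_eq_right)
        also have "y k powr (- 2) * (\<Prod>j\<in>V - {k}. ?factor j) = lam y"
          using pareto_density_eq_tree_product[OF rooted_tree_axioms lam assms(6) Lam, of y] True
          by (simp add: Let_def)
        finally show ?thesis
          using True by simp
      next
        case False
        \<comment> \<open>All \<open>F i\<close> vanish on nonpositive arguments and
          \<open>F k\<close> vanishes up to 1, so the support lies in the conditioned
          orthant.\<close>
        have "tree_density F V y = 0"
        proof (rule ccontr)
          assume nz: "tree_density F V y \<noteq> 0"
          then have "y \<in> pos_orthant V"
            using tree_density_nonzero[OF nz finite_V _ F_zero] elim
            by (auto simp: pos_orthant_def space_PiM PiE_iff)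
          moreover have "1 < y k"
            using nz by (auto simp: tree_density_def F_def indicator_def split: if_splits)
          ultimately show False
            using False by simp
        qed
        with False show ?thesis
          by auto
      qed
    qed
    show "tree_density F V \<in> borel_measurable (lborel_on V)"
      using subtree_V F_meas by (rule tree_density_measurable)
    have "(\<lambda>y. ennreal (lam y) * indicator (pos_orthant V) y * indicator {1<..} (y k)) \<in> borel_measurable (borel_on V)"
      using borel_measurable_continuous_on_pos_orthant[OF finite_V, of lam] lam assms(7)
      by (simp add: exponent_measure_density_def)
    also have "(\<lambda>y. ennreal (lam y) * indicator (pos_orthant V) y * indicator {1<..} (y k)) =
        (\<lambda>y. ennreal (lam y) * indicator {y \<in> pos_orthant V. 1 < y k} y)"
      by (auto simp: indicator_def)
    finally show "(\<lambda>y. ennreal (lam y) * indicator {y \<in> pos_orthant V. 1 < y k} y) \<in> borel_measurable (lborel_on V)"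
      using sets by (simp cong: measurable_cong_sets)
  qed
  also have "\<dots> = distr (uniform_measure M {w \<in> space M. Y w k > 1}) (borel_on V) Y"
    using distr_conditional_pareto[OF finite_V assms(7,4,5)] by simp
  finally show ?thesis
    by simp
qed

end
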